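(* Let $s=0$, and assume that all pieces, both in partitions and in allocations, must be pairwise disjoint (empty-intersection setting). Let $G$ be any finite graph and let $r=\mathrm{FvsNum}(G)$. Then for any $n\ge1$ agents with arbitrary monotone (continuous, nonnegative) valuations, there exists an allocation of $G$ in which each agent $i$ receives a connected piece $A_i$ with $v_i(A_i)\ge \mathrm{MMS}_i^{n+r}$.
   Context: Cake model: the cake is a finite undirected graph $G=(V,E)$, not necessarily connected, in which every edge is a segment of positive length; points of $G$ are its vertices and the points on its edges. A piece of cake is a finite union of intervals (open, half-open or closed) contained in edges, together possibly with some vertices. A piece $X$ is connected if any two points of $X$ can be joined by a path in $G$ that stays inside $X$. Each agent $i\in[n]$ has a valuation $v_i$ on pieces of cake that is nonnegative, monotone and continuous; in particular, single points have value $0$. Empty-intersection setting with $s=0$: a $k$-partition is a set of $k$ pairwise disjoint connected pieces. An allocation is a vector $(A_1,\dots,A_n)$ of pairwise disjoint connected pieces. Maximin share: $\mathrm{MMS}_i^{k}=\sup\min_{j\in[k]}v_i(P_j)$, where the supremum ranges over $k$-partitions $\{P_1,\dots,P_k\}$. $\mathrm{FvsNum}(G)$ (feedback vertex set number) is the minimum number of vertices whose removal from $G$ leaves an acyclic graph. *)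

theory Defs
  imports "HOL-Analysis.Analysis"
begin

record ('v, 'e) cgraph =
  verts :: "'v set"
  edges :: "'e set"
  ends  :: "'e \<Rightarrow> 'v \<times> 'v"
  elen  :: "'e \<Rightarrow> real"

definition wf_cgraph :: "('v, 'e) cgraph \<Rightarrow> bool" where
  "wf_cgraph G \<longleftrightarrow> finite (verts G) \<and> finite (edges G) \<and>
     (\<forall>e\<in>edges G. fst (ends G e) \<in> verts G \<and> snd (ends G e) \<in> verts G \<and> elen G e > 0)"

datatype ('v, 'e) pt = Vtx 'v | Pt 'e real

definition points :: "('v, 'e) cgraph \<Rightarrow> ('v, 'e) pt set" where
  "points G = Vtx ` verts G \<union> {Pt e t | e t. e \<in> edges G \<and> 0 < t \<and> t < elen G e}"

definition edge_map :: "('v, 'e) cgraph \<Rightarrow> 'e \<Rightarrow> real \<Rightarrow> ('v, 'e) pt" where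
  "edge_map G e t = (if t \<le> 0 then Vtx (fst (ends G e))
                     else if elen G e \<le> t then Vtx (snd (ends G e)) else Pt e t)"

text \<open>The topology of the geometric realisation of G (quotient topology of the segments).\<close>
definition cake_top :: "('v, 'e) cgraph \<Rightarrow> ('v, 'e) pt topology" where
  "cake_top G = topology (\<lambda>U. U \<subseteq> points G \<and>
     (\<forall>e\<in>edges G. openin (top_of_set {0..elen G e})
                      {t \<in> {0..elen G e}. edge_map G e t \<in> U}))"

definition edge_part :: "('v, 'e) cgraph \<Rightarrow> 'e \<Rightarrow> ('v, 'e) pt set \<Rightarrow> real set" where
  "edge_part G e X = {t. 0 < t \<and> t < elen G e \<and> Pt e t \<in> X}"

definition is_piece :: "('v, 'e) cgraph \<Rightarrow> ('v, 'e) pt set \<Rightarrow> bool" where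
  "is_piece G X \<longleftrightarrow> X \<subseteq> points G \<and>
     (\<forall>e\<in>edges G. \<exists>F. finite F \<and> (\<forall>I\<in>F. is_interval I) \<and> edge_part G e X = \<Union>F)"

definition conn_piece :: "('v, 'e) cgraph \<Rightarrow> ('v, 'e) pt set \<Rightarrow> bool" where
  "conn_piece G X \<longleftrightarrow> is_piece G X \<and> path_connectedin (cake_top G) X"

definition piece_len :: "('v, 'e) cgraph \<Rightarrow> ('v, 'e) pt set \<Rightarrow> real" where
  "piece_len G X = (\<Sum>e\<in>edges G. measure lborel (edge_part G e X))"

definition valuation :: "('v, 'e) cgraph \<Rightarrow> (('v, 'e) pt set \<Rightarrow> real) \<Rightarrow> bool" where
  "valuation G v \<longleftrightarrow>
     (\<forall>X. is_piece G X \<longrightarrow> 0 \<le> v X) \<and>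
     (\<forall>X Y. is_piece G X \<longrightarrow> is_piece G Y \<longrightarrow> X \<subseteq> Y \<longrightarrow> v X \<le> v Y) \<and>
     (\<forall>X. is_piece G X \<longrightarrow> (\<forall>\<epsilon>>0. \<exists>\<delta>>0. \<forall>Y. is_piece G Y \<longrightarrow>
          piece_len G ((X - Y) \<union> (Y - X)) < \<delta> \<longrightarrow> \<bar>v X - v Y\<bar> < \<epsilon>)) \<and>
     (\<forall>p\<in>points G. v {p} = 0)"

definition is_partition :: "('v, 'e) cgraph \<Rightarrow> nat \<Rightarrow> (nat \<Rightarrow> ('v, 'e) pt set) \<Rightarrow> bool" where
  "is_partition G k P \<longleftrightarrow> (\<forall>j<k. conn_piece G (P j)) \<and>
     (\<forall>i<k. \<forall>j<k. i \<noteq> j \<longrightarrow> P i \<inter> P j = {})"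

definition mms :: "('v, 'e) cgraph \<Rightarrow> (('v, 'e) pt set \<Rightarrow> real) \<Rightarrow> nat \<Rightarrow> real" where
  "mms G v k = Sup ((\<lambda>P. Min ((\<lambda>j. v (P j)) ` {..<k})) ` {P. is_partition G k P})"

text \<open>Cycles in the subgraph of G obtained by deleting the vertex set S
  (cycle of length m \<ge> 1: distinct vertices and distinct edges, cyclically joined;
   covers loops (m = 1) and pairs of parallel edges (m = 2)).\<close>
definition has_cycle_minus :: "('v, 'e) cgraph \<Rightarrow> 'v set \<Rightarrow> bool" where
  "has_cycle_minus G S \<longleftrightarrow> (\<exists>vs es. es \<noteq> [] \<and> length vs = length es \<and>
     distinct vs \<and> distinct es \<and> set vs \<subseteq> verts G - S \<and> set es \<subseteq> edges G \<and>
     (\<forall>i<length es. ends G (es ! i) = (vs ! i, vs ! ((i + 1) mod length es)) \<or>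
                    ends G (es ! i) = (vs ! ((i + 1) mod length es), vs ! i)))"

definition fvs_num :: "('v, 'e) cgraph \<Rightarrow> nat" where
  "fvs_num G = (LEAST r. \<exists>S. S \<subseteq> verts G \<and> card S = r \<and> \<not> has_cycle_minus G S)"

end

(*
  Let S be a feedback vertex set of size r. Of n + r disjoint pieces at most r meet S, so for every
  agent the forest left after deleting S still contains n disjoint connected pieces worth nearly its
  maximin share. Call a connected set small if every remaining agent values it below its share. We
  absorb leaf edges of the forest into the bag of their other end as long as the bags stay small.
  As soon as some agent is satisfied by a branch, we cut the branch off at the lowest point where
  this happens and give it to that agent. By minimality each other agent loses at most one piece of
  its partition and an arbitrarily small part of another one. As the supremum in the maximin share
  need not be attained a priori, the invariant only asks for pieces worth at least c, for each c
  below the share, and the small loss is controlled by uniform continuity of the valuations.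
*)
theory Submission
  imports Defs
begin

text \<open>Absorbing a branch makes values jump: two small sets may have a satisfying union, and
  then there is no lowest cut point. The enlarged bag is handed out whole. What bounds the loss of
  the others is recorded in \<open>agent_ok\<close>: a connected piece that meets a bag without
  containing its vertex is trapped in one absorbed branch, and each branch was too small for every
  remaining agent when it was absorbed. So among pieces worth nearly the share only the one through
  the vertex is lost. A cut has a different difficulty, the order of choices: the small set
  \<open>Y\<close> depends on the admissible loss of length, the value demanded of the pieces must
  exceed that of \<open>Y\<close>, and only then are the pieces known. A tolerance belonging to a
  single piece would come too late, so one tolerance has to serve all connected pieces. It exists by
  compactness, because up to finitely many points a connected piece is described by four endpoints
  on each edge. Both arguments see the geometry only through \<open>gate\<close>, a set with one
  exit: a connected set avoiding the exit is inside or disjoint.\<close>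

section \<open>The Boolean algebra of finite unions of intervals\<close>

definition fin_intervals :: "real set \<Rightarrow> bool" where
  "fin_intervals A \<longleftrightarrow> (\<exists>F. finite F \<and> (\<forall>I\<in>F. is_interval I) \<and> A = \<Union>F)"

lemma fin_intervals_interval: "is_interval A \<Longrightarrow> fin_intervals A"
  unfolding fin_intervals_def by (rule exI[of _ "{A}"]) simp

lemma fin_intervals_Un:
  assumes "fin_intervals A" "fin_intervals B"
  shows "fin_intervals (A \<union> B)"
proof -
  obtain F F' where "finite F" "\<forall>I\<in>F. is_interval I" "A = \<Union>F"
    "finite F'" "\<forall>I\<in>F'. is_interval I" "B = \<Union>F'"
    using assms unfolding fin_intervals_def by blast
  then show ?thesis unfolding fin_intervals_def by (intro exI[of _ "F \<union> F'"]) auto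
qed

lemma fin_intervals_Int:
  assumes "fin_intervals A" "fin_intervals B"
  shows "fin_intervals (A \<inter> B)"
proof -
  obtain F F' where F: "finite F" "\<forall>I\<in>F. is_interval I" "A = \<Union>F"
    and F': "finite F'" "\<forall>I\<in>F'. is_interval I" "B = \<Union>F'"
    using assms unfolding fin_intervals_def by blast
  let ?H = "(\<lambda>(I, J). I \<inter> J) ` (F \<times> F')"
  have "finite ?H" using F F' by simp
  moreover have "\<forall>I\<in>?H. is_interval I" using F F' by (auto intro: is_interval_Int)
  moreover have "A \<inter> B = \<Union>?H" using F F' by auto
  ultimately show ?thesis unfolding fin_intervals_def by blast
qed

text \<open>A point outside an interval lies below all of it or above all of it, which leaves two
  rays.\<close>

lemma fin_intervals_Compl_interval:
  assumes "is_interval (I :: real set)"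
  shows "fin_intervals (- I)"
proof (cases "I = {}")
  case True
  then show ?thesis by (simp add: fin_intervals_interval)
next
  case False
  have "- I = {x. \<forall>y\<in>I. x < y} \<union> {x. \<forall>y\<in>I. y < x}"
  proof -
    have "(\<forall>y\<in>I. x < y) \<or> (\<forall>y\<in>I. y < x)" if "x \<notin> I" for x
      using assms that unfolding is_interval_1 by (meson linorder_not_less)
    with False show ?thesis by force
  qed
  moreover have "is_interval {x. \<forall>y\<in>I. x < y}" "is_interval {x. \<forall>y\<in>I. y < x}"
    unfolding is_interval_1 by force+
  ultimately show ?thesis using fin_intervals_Un fin_intervals_interval by metis
qed

lemma fin_intervals_Compl:
  assumes "fin_intervals A"
  shows "fin_intervals (- A)"
proof -
  obtain F where F: "finite F" "\<forall>I\<in>F. is_interval I" "A = \<Union>F"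
    using assms unfolding fin_intervals_def by blast
  have "fin_intervals (- \<Union>F)" using F(1,2)
  proof (induction F)
    case empty
    then show ?case by (simp add: fin_intervals_interval)
  next
    case (insert I F)
    have "- \<Union>(insert I F) = - I \<inter> - \<Union>F" by blast
    then show ?case using insert fin_intervals_Int fin_intervals_Compl_interval by simp
  qed
  then show ?thesis using F by simp
qed

lemma fin_intervals_Diff: "fin_intervals A \<Longrightarrow> fin_intervals B \<Longrightarrow> fin_intervals (A - B)"
  by (simp add: Diff_eq fin_intervals_Compl fin_intervals_Int)

lemma fin_intervals_borel:
  assumes "fin_intervals A"
  shows "A \<in> sets borel"
proof -
  obtain F where F: "finite F" "\<forall>I\<in>F. is_interval I" "A = \<Union>F"
    using assms unfolding fin_intervals_def by blast
  have "\<Union>F \<in> sets borel"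
    by (rule sets.finite_Union) (use F real_interval_borel_measurable in auto)
  with F show ?thesis by simp
qed

section \<open>Pieces, and open and closed segments of an edge\<close>

lemma is_piece_iff:
  "is_piece G X \<longleftrightarrow> X \<subseteq> points G \<and> (\<forall>e\<in>edges G. fin_intervals (edge_part G e X))"
  by (simp add: is_piece_def fin_intervals_def)

lemma edge_part_Un: "edge_part G e (X \<union> Y) = edge_part G e X \<union> edge_part G e Y"
  and edge_part_Diff: "edge_part G e (X - Y) = edge_part G e X - edge_part G e Y"
  by (auto simp: edge_part_def)

lemma is_piece_empty [simp]: "is_piece G {}"
  by (simp add: is_piece_iff edge_part_def fin_intervals_interval)

lemma is_piece_Un: "is_piece G X \<Longrightarrow> is_piece G Y \<Longrightarrow> is_piece G (X \<union> Y)"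
  by (simp add: is_piece_iff edge_part_Un fin_intervals_Un)

lemma is_piece_Diff: "is_piece G X \<Longrightarrow> is_piece G Y \<Longrightarrow> is_piece G (X - Y)"
  by (auto simp: is_piece_iff edge_part_Diff fin_intervals_Diff)

lemma is_piece_Vtx: "w \<in> verts G \<Longrightarrow> is_piece G {Vtx w}"
  by (simp add: is_piece_iff edge_part_def fin_intervals_interval points_def)

text \<open>Built on \<open>open_segment\<close> so that the two positions may come in either order,
  as arcs are traversed both ways. Equal positions give the empty set.\<close>

definition seg :: "'e \<Rightarrow> real \<Rightarrow> real \<Rightarrow> ('v, 'e) pt set" where
  "seg e a b = Pt e ` open_segment a b"

lemma seg_commute: "seg e a b = seg e b a"
  by (simp add: seg_def open_segment_commute)

lemma open_segment_real_subset:
  fixes a b c d :: real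
  assumes "a \<in> {c..d}" "b \<in> {c..d}"
  shows "open_segment a b \<subseteq> {c<..<d}"
  using assms by (auto simp: open_segment_eq_real_ivl split: if_splits)

lemma edge_part_seg:
  assumes "a \<in> {0..elen G e}" "b \<in> {0..elen G e}"
  shows "edge_part G e' (seg e a b) = (if e' = e then open_segment a b else {})"
  using open_segment_real_subset[OF assms] by (auto simp: edge_part_def seg_def)

lemma is_piece_seg:
  assumes "e \<in> edges G" "a \<in> {0..elen G e}" "b \<in> {0..elen G e}"
  shows "is_piece G (seg e a b)"
proof -
  have "seg e a b \<subseteq> points G"
    using open_segment_real_subset[OF assms(2,3)] assms(1) by (auto simp: seg_def points_def)
  moreover have "is_interval (open_segment a b)"
    by (simp add: open_segment_eq_real_ivl)
  ultimately show ?thesis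
    using assms by (simp add: is_piece_iff edge_part_seg fin_intervals_interval)
qed

text \<open>Here \<open>edge_map\<close> replaces the constructor \<open>Pt\<close>, because the end
  positions may be vertices.\<close>

definition cseg :: "('v, 'e) cgraph \<Rightarrow> 'e \<Rightarrow> real \<Rightarrow> real \<Rightarrow> ('v, 'e) pt set" where
  "cseg G e a b = edge_map G e ` closed_segment a b"

lemma edge_map_inner: "0 < t \<Longrightarrow> t < elen G e \<Longrightarrow> edge_map G e t = Pt e t"
  by (simp add: edge_map_def)

lemma cseg_eq:
  assumes "a \<in> {0..elen G e}" "b \<in> {0..elen G e}"
  shows "cseg G e a b = seg e a b \<union> {edge_map G e a, edge_map G e b}"
proof -
  have "edge_map G e t = Pt e t" if "t \<in> open_segment a b" for t
    using subsetD[OF open_segment_real_subset[OF assms] that] by (simp add: edge_map_inner)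
  then have "edge_map G e ` open_segment a b = seg e a b"
    unfolding seg_def by (rule image_cong[OF refl])
  then show ?thesis unfolding cseg_def closed_segment_eq_open by blast
qed

section \<open>Topology of the cake\<close>

text \<open>Taking preimages under \<open>edge_map\<close> commutes with intersections and unions,
  so the defining predicate is an \<open>istopology\<close> and the abstraction can be
  unfolded.\<close>

lemma openin_cake_top:
  "openin (cake_top G) U \<longleftrightarrow> U \<subseteq> points G \<and>
     (\<forall>e\<in>edges G. openin (top_of_set {0..elen G e}) {t \<in> {0..elen G e}. edge_map G e t \<in> U})"
proof -
  let ?L = "\<lambda>U. U \<subseteq> points G \<and>
     (\<forall>e\<in>edges G. openin (top_of_set {0..elen G e}) {t \<in> {0..elen G e}. edge_map G e t \<in> U})"
  have Int: "?L (S \<inter> T)" if "?L S" "?L T" for S T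
  proof -
    have "{t \<in> {0..elen G e}. edge_map G e t \<in> S \<inter> T} =
      {t \<in> {0..elen G e}. edge_map G e t \<in> S} \<inter> {t \<in> {0..elen G e}. edge_map G e t \<in> T}" for e
      by blast
    with that show ?thesis by (metis (no_types, lifting) le_infI1 openin_Int)
  qed
  have Un: "?L (\<Union>\<K>)" if "\<forall>S\<in>\<K>. ?L S" for \<K>
  proof -
    have "{t \<in> {0..elen G e}. edge_map G e t \<in> \<Union>\<K>} =
      (\<Union>S\<in>\<K>. {t \<in> {0..elen G e}. edge_map G e t \<in> S})" for e
      by blast
    with that show ?thesis by (auto intro!: openin_Union)
  qed
  have "istopology ?L" unfolding istopology_def using Int Un by blast
  then show ?thesis unfolding cake_top_def by (simp add: topology_inverse')
qed

locale cake =
  fixes G :: "('v, 'e) cgraph"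
  assumes wf: "wf_cgraph G"
begin

abbreviation "T \<equiv> cake_top G"

lemma finite_edges: "finite (edges G)" and finite_verts: "finite (verts G)"
  and elen_pos: "e \<in> edges G \<Longrightarrow> 0 < elen G e"
  using wf by (auto simp: wf_cgraph_def)

lemma edge_map_points: "e \<in> edges G \<Longrightarrow> edge_map G e t \<in> points G"
  using wf by (auto simp: edge_map_def points_def wf_cgraph_def)

lemma topspace_cake [simp]: "topspace T = points G"
proof -
  have "{t \<in> {0..elen G e}. edge_map G e t \<in> points G} = {0..elen G e}" if "e \<in> edges G" for e
    using edge_map_points[OF that] by auto
  then have "openin T (points G)" by (simp add: openin_cake_top)
  then show ?thesis by (metis openin_cake_top openin_subset openin_topspace subset_antisym)
qed

lemma closedin_cake:
  assumes "C \<subseteq> points G"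
    and "\<And>e. e \<in> edges G \<Longrightarrow> closed {t \<in> {0..elen G e}. edge_map G e t \<in> C}"
  shows "closedin T C"
proof -
  have "openin (top_of_set {0..elen G e}) {t \<in> {0..elen G e}. edge_map G e t \<in> points G - C}"
    if e: "e \<in> edges G" for e
  proof -
    have "{t \<in> {0..elen G e}. edge_map G e t \<in> points G - C} =
      {0..elen G e} \<inter> - {t \<in> {0..elen G e}. edge_map G e t \<in> C}"
      using edge_map_points[OF e] by auto
    moreover have "openin (top_of_set {0..elen G e})
        ({0..elen G e} \<inter> - {t \<in> {0..elen G e}. edge_map G e t \<in> C})"
      by (intro openin_open_Int open_Compl assms(2) e)
    ultimately show ?thesis by simp
  qed
  with assms(1) show ?thesis by (simp add: closedin_def openin_cake_top)
qed

lemma openin_seg: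
  assumes "e \<in> edges G" "a \<in> {0..elen G e}" "b \<in> {0..elen G e}"
  shows "openin T (seg e a b)"
proof -
  have sub: "open_segment a b \<subseteq> {0<..<elen G e}"
    using assms open_segment_real_subset by blast
  have "{t \<in> {0..elen G e'}. edge_map G e' t \<in> seg e a b} =
    {0..elen G e'} \<inter> (if e' = e then open_segment a b else {})" for e'
    using sub by (auto simp: edge_map_def seg_def subset_iff split: if_splits)
  moreover have "open (open_segment a b)" by (simp add: open_segment_eq_real_ivl)
  ultimately have "openin (top_of_set {0..elen G e'}) {t \<in> {0..elen G e'}. edge_map G e' t \<in> seg e a b}" for e'
    by (auto intro!: openin_open_Int)
  moreover have "seg e a b \<subseteq> points G"
    using is_piece_seg[OF assms] by (simp add: is_piece_def)
  ultimately show ?thesis by (simp add: openin_cake_top)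
qed

lemma closedin_cseg:
  assumes e: "e \<in> edges G" and a: "a \<in> {0..elen G e}" and b: "b \<in> {0..elen G e}"
  shows "closedin T (cseg G e a b)"
proof (rule closedin_cake)
  show "cseg G e a b \<subseteq> points G" using edge_map_points[OF e] by (auto simp: cseg_def)
  fix e' assume e': "e' \<in> edges G"
  let ?D = "{t \<in> {0..elen G e'}. edge_map G e' t \<in> cseg G e a b}"
  have cs: "closed_segment a b \<subseteq> {0..elen G e}"
    using a b by (auto simp: closed_segment_eq_real_ivl split: if_splits)
  have inner: "edge_map G e' t \<in> cseg G e a b \<longleftrightarrow> e' = e \<and> t \<in> closed_segment a b"
    if "0 < t" "t < elen G e'" for t
    using that cs by (fastforce simp: cseg_def edge_map_def)
  have "t \<in> {0, elen G e'} \<or> (0 < t \<and> t < elen G e')" if "t \<in> {0..elen G e'}" for t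
    using that by auto
  moreover have "closed_segment a b \<subseteq> ?D" if "e' = e"
    using cs that by (auto simp: cseg_def)
  \<comment> \<open>Off the two ends of \<open>e'\<close> the preimage is the segment itself or
    empty. What the ends contribute depends on which vertices coincide, but it is finite and hence
    closed.\<close>
  ultimately have D: "?D = (if e' = e then closed_segment a b else {}) \<union> (?D \<inter> {0, elen G e'})"
    using inner by (auto split: if_splits)
  have "closed (if e' = e then closed_segment a b else {})"
    by (simp add: closed_segment_eq_real_ivl)
  moreover have "closed (?D \<inter> {0, elen G e'})" by (rule finite_imp_closed) simp
  ultimately have "closed ((if e' = e then closed_segment a b else {}) \<union> (?D \<inter> {0, elen G e'}))"
    by (rule closed_Un)
  then show "closed ?D" using D by simp
qed

lemma continuous_edge_map:
  assumes "e \<in> edges G"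
  shows "continuous_map (top_of_set {0..elen G e}) T (edge_map G e)"
  using assms edge_map_points by (auto simp: continuous_map_def openin_cake_top)

lemma path_connectedin_edge_image:
  assumes "e \<in> edges G" "path_connected S" "S \<subseteq> {0..elen G e}"
  shows "path_connectedin T (edge_map G e ` S)"
proof (rule path_connectedin_continuous_map_image[OF continuous_edge_map[OF assms(1)]])
  show "path_connectedin (top_of_set {0..elen G e}) S"
    using assms by (simp add: path_connectedin_subtopology)
qed

lemma path_connectedin_Un:
  assumes "path_connectedin T A" "path_connectedin T B" "x \<in> A" "x \<in> B"
  shows "path_connectedin T (A \<union> B)"
  using path_connectedin_Union[of "{A, B}" T] assms by auto

text \<open>The point p, which need not belong to R, is the only exit of X within R.\<close>
definition gate where
  "gate R X p \<longleftrightarrow> X \<subseteq> R \<and> p \<notin> X \<and> openin (subtopology T R) X \<and>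
     openin (subtopology T R) (R - X - {p})"

text \<open>The sets \<open>X\<close> and \<open>R - X - {p}\<close> are disjoint, relatively open,
  and cover \<open>P\<close> once \<open>p\<close> is missing from it. Connectedness forbids
  \<open>P\<close> to meet both.\<close>

lemma gate_avoid:
  assumes "gate R X p" "path_connectedin T P" "P \<subseteq> R" "p \<notin> P"
  shows "P \<subseteq> X \<or> P \<inter> X = {}"
proof -
  have "connectedin (subtopology T R) P"
    using assms by (simp add: connectedin_subtopology path_connectedin_imp_connectedin)
  then have "\<not> (\<exists>E1 E2. openin (subtopology T R) E1 \<and> openin (subtopology T R) E2 \<and>
             P \<subseteq> E1 \<union> E2 \<and> E1 \<inter> E2 \<inter> P = {} \<and> E1 \<inter> P \<noteq> {} \<and> E2 \<inter> P \<noteq> {})"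
    unfolding connectedin by blast
  from this[simplified, rule_format, of X "R - X - {p}"] show ?thesis
    using assms unfolding gate_def by blast
qed

text \<open>If \<open>p\<close> lies in \<open>P\<close>, collapsing \<open>X\<close> to
  \<open>p\<close> is a retraction of \<open>P\<close> onto \<open>P - X\<close>, and path
  connectedness passes to the image. Otherwise \<open>P\<close> lies entirely on one side.\<close>

lemma gate_trim:
  assumes g: "gate R X p" and P: "path_connectedin T P" and PR: "P \<subseteq> R"
  shows "path_connectedin T (P - X)"
proof (cases "p \<in> P")
  case False
  then show ?thesis using gate_avoid[OF g P PR] P
    by (metis Diff_eq_empty_iff Diff_triv path_connectedin_empty)
next
  case True
  define r where "r x = (if x \<in> X then p else x)" for x
  have "continuous_map (subtopology T P) T r"
  proof -
    have PT: "P \<subseteq> points G" using P by (metis path_connectedin_subset_topspace topspace_cake)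
    have pR: "p \<in> R" "p \<notin> X" "X \<subseteq> R" using True PR g by (auto simp: gate_def)
    have opR: "openin (subtopology T R) U \<Longrightarrow> openin (subtopology T P) (P \<inter> U)" for U
      using PR by (metis inf.absorb2 openin_subtopology_Int2 subtopology_subtopology)
    have o1: "openin (subtopology T P) (P \<inter> X)" "openin (subtopology T P) (P - X - {p})"
    proof -
      have "P \<inter> (R - X - {p}) = P - X - {p}" using PR by blast
      then show "openin (subtopology T P) (P \<inter> X)" "openin (subtopology T P) (P - X - {p})"
        using opR[of X] opR[of "R - X - {p}"] g unfolding gate_def by auto
    qed
    show ?thesis
    proof (unfold continuous_map_def, intro conjI allI impI)
      show "r \<in> topspace (subtopology T P) \<rightarrow> topspace T"
        using PT True by (auto simp: r_def)
      fix U assume U: "openin T U"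
      have PU: "openin (subtopology T P) (P \<inter> U)"
        using U by (simp add: openin_subtopology_Int2)
      have ts: "topspace (subtopology T P) = P" using PT by auto
      show "openin (subtopology T P) {x \<in> topspace (subtopology T P). r x \<in> U}"
      \<comment> \<open>Each case uses one openness clause of \<open>gate\<close>: if
        \<open>p\<close> is in \<open>U\<close>, the preimage is the trace of \<open>U\<close>
        enlarged by \<open>X\<close>; if not, it is the trace of \<open>U\<close> cut down to
        \<open>R - X - {p}\<close>.\<close>
      proof (cases "p \<in> U")
        case True
        have "{x \<in> P. r x \<in> U} = (P \<inter> U) \<union> (P \<inter> X)" using True by (auto simp: r_def)
        then show ?thesis using o1 PU ts by (metis openin_Un)
      next
        case False
        have "{x \<in> P. r x \<in> U} = (P \<inter> U) \<inter> (P - X - {p})" using False by (auto simp: r_def)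
        then show ?thesis using o1 PU ts by (metis openin_Int)
      qed
    qed
  qed
  moreover have "path_connectedin (subtopology T P) P" using P by simp
  ultimately have "path_connectedin T (r ` P)" by (rule path_connectedin_continuous_map_image)
  moreover have "r ` P = P - X" using True g by (auto simp: r_def gate_def image_iff)
  ultimately show ?thesis by simp
qed

lemma conn_piece_trim:
  assumes "gate R X p" "conn_piece G P" "P \<subseteq> R" "is_piece G X"
  shows "conn_piece G (P - X)"
  using assms gate_trim is_piece_Diff unfolding conn_piece_def by blast

end

section \<open>Length and uniform continuity\<close>

lemma edge_part_fmeasurable:
  assumes "is_piece G X" "e \<in> edges G"
  shows "edge_part G e X \<in> fmeasurable lborel"
proof (rule fmeasurableI2)
  show "{0..elen G e} \<in> fmeasurable lborel"
    by (rule fmeasurableI) (simp_all add: emeasure_lborel_Icc_eq)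
  show "edge_part G e X \<subseteq> {0..elen G e}" by (auto simp: edge_part_def)
  show "edge_part G e X \<in> sets lborel"
    using assms by (auto simp: is_piece_iff fin_intervals_borel)
qed

lemma edge_part_borel: "is_piece G X \<Longrightarrow> e \<in> edges G \<Longrightarrow> edge_part G e X \<in> sets borel"
  by (simp add: is_piece_iff fin_intervals_borel)

lemma piece_len_mono:
  assumes "is_piece G X" "is_piece G Y" "X \<subseteq> Y"
  shows "piece_len G X \<le> piece_len G Y"
  unfolding piece_len_def
proof (intro sum_mono measure_mono_fmeasurable)
  fix e assume "e \<in> edges G"
  then show "edge_part G e X \<in> sets lborel" "edge_part G e Y \<in> fmeasurable lborel"
    using assms edge_part_fmeasurable by (auto simp: edge_part_borel)
  show "edge_part G e X \<subseteq> edge_part G e Y" using assms by (auto simp: edge_part_def)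
qed

lemma piece_len_Un:
  assumes "is_piece G X" "is_piece G Y"
  shows "piece_len G (X \<union> Y) \<le> piece_len G X + piece_len G Y"
  unfolding piece_len_def sum.distrib[symmetric] edge_part_Un
  using assms by (intro sum_mono measure_Un_le) (auto simp: edge_part_borel)

lemma piece_len_Diff:
  assumes "is_piece G X" "is_piece G Y" "Y \<subseteq> X"
  shows "piece_len G (X - Y) = piece_len G X - piece_len G Y"
  unfolding piece_len_def sum_subtractf[symmetric] edge_part_Diff
proof (intro sum.cong refl measure_Diff)
  fix e assume e: "e \<in> edges G"
  show "emeasure lborel (edge_part G e X) \<noteq> \<infinity>"
    using fmeasurableD2[OF edge_part_fmeasurable[OF assms(1) e]] by simp
  show "edge_part G e X \<in> sets lborel" "edge_part G e Y \<in> sets lborel"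
    using assms e by (simp_all add: edge_part_borel)
  show "edge_part G e Y \<subseteq> edge_part G e X" using assms by (auto simp: edge_part_def)
qed

lemma is_interval_approx:
  fixes A :: "real set"
  assumes "is_interval A" "A \<subseteq> {0<..<L}" "0 < L"
  shows "\<exists>a b. 0 \<le> a \<and> a \<le> b \<and> b \<le> L \<and> {a<..<b} \<subseteq> A \<and> A \<subseteq> {a..b}"
proof (cases "A = {}")
  case True
  with assms show ?thesis by (intro exI[of _ 0]) auto
next
  case False
  have bdd: "bdd_below A" "bdd_above A" using assms(2)
    by (meson bdd_below_mono bdd_below_Ioo bdd_above_mono bdd_above_Ioo)+
  have "{Inf A<..<Sup A} \<subseteq> A"
  proof
    fix x assume "x \<in> {Inf A<..<Sup A}"
    then obtain y z where "y \<in> A" "y < x" "z \<in> A" "x < z"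
      using cInf_lessD[OF False] less_cSupD[OF False] by force
    with assms(1) show "x \<in> A" unfolding is_interval_1 by (meson less_imp_le)
  qed
  moreover have "A \<subseteq> {Inf A..Sup A}" using bdd by (auto intro: cInf_lower cSup_upper)
  moreover obtain x where "x \<in> A" using False by blast
  moreover have "0 \<le> Inf A" using False assms(2) by (intro cInf_greatest) auto
  moreover have "Sup A \<le> L" using False assms(2) by (intro cSup_least) auto
  ultimately show ?thesis by (intro exI[of _ "Inf A"] exI[of _ "Sup A"]) force
qed

text \<open>The shape of the trace of a connected piece on one edge. Encoding the four endpoints as
  a function lets limits be formed coordinate by coordinate; only the arguments 0 to 3 matter, and
  endpoints in the wrong order give an empty interval.\<close>

definition two_intervals :: "(nat \<Rightarrow> real) \<Rightarrow> real set" where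
  "two_intervals f = {f 0<..<f 1} \<union> {f 2<..<f 3}"

text \<open>A point on which \<open>f\<close> and \<open>l\<close> disagree lies between
  \<open>f i\<close> and \<open>l i\<close> for some \<open>i < 4\<close>. Apart from the finite
  error of \<open>f\<close>, four intervals of these lengths cover the difference.\<close>

lemma two_intervals_sdiff:
  assumes "finite ((A - two_intervals f) \<union> (two_intervals f - A))" "A \<in> sets borel"
  shows "measure lborel ((A - two_intervals l) \<union> (two_intervals l - A)) \<le> (\<Sum>i<4. \<bar>f i - l i\<bar>)"
proof -
  define N where "N = (A - two_intervals f) \<union> (two_intervals f - A)"
  let ?C = "\<lambda>i. {min (f i) (l i)..max (f i) (l i)}"
  have "x \<in> (\<Union>i<4. ?C i)"
    if "(x \<in> two_intervals f) \<noteq> (x \<in> two_intervals l)" for x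
  proof (rule ccontr)
    assume x: "x \<notin> (\<Union>i<4. ?C i)"
    then have *: "\<forall>i<4. (f i < x \<longleftrightarrow> l i < x) \<and> (x < f i \<longleftrightarrow> x < l i)" by force
    from *[rule_format, of 0] *[rule_format, of 1] *[rule_format, of 2] *[rule_format, of 3] that
    show False by (auto simp: two_intervals_def)
  qed
  then have sub: "(A - two_intervals l) \<union> (two_intervals l - A) \<subseteq> N \<union> (\<Union>i<4. ?C i)"
    unfolding N_def by blast
  have finN: "finite N" using assms(1) by (simp add: N_def)
  have "measure lborel ((A - two_intervals l) \<union> (two_intervals l - A))
      \<le> measure lborel (N \<union> (\<Union>i<4. ?C i))"
  proof (rule measure_mono_fmeasurable[OF sub])
    show "(A - two_intervals l) \<union> (two_intervals l - A) \<in> sets lborel"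
      using assms(2) by (auto simp: two_intervals_def)
    have "?C i \<in> fmeasurable lborel" for i
      by (rule fmeasurableI) (simp_all add: emeasure_lborel_Icc_eq)
    moreover have "N \<in> fmeasurable lborel"
      using finN by (intro fmeasurableI_null_sets finite_imp_null_set_lborel)
    ultimately show "N \<union> (\<Union>i<4. ?C i) \<in> fmeasurable lborel"
      by (intro fmeasurable.Un fmeasurable.finite_UN) auto
  qed
  also have "\<dots> \<le> measure lborel N + measure lborel (\<Union>i<4. ?C i)"
    using finN by (intro measure_Un_le) (auto simp: borel_closed finite_imp_closed)
  also have "measure lborel N = 0"
    using finN by (intro measure_eq_0_null_sets finite_imp_null_set_lborel)
  also have "measure lborel (\<Union>i<4. ?C i) \<le> (\<Sum>i<4. measure lborel (?C i))"
    by (intro measure_UNION_le) auto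
  also have "(\<Sum>i<4. measure lborel (?C i)) = (\<Sum>i<4. \<bar>f i - l i\<bar>)"
    by (intro sum.cong refl) (simp add: max_def min_def abs_if)
  finally show ?thesis by simp
qed

text \<open>Compactness of an interval is applied to one coordinate after the other, each time
  passing to a further subsequence.\<close>

lemma convergent_subsequence_finite:
  fixes f :: "nat \<Rightarrow> 'i \<Rightarrow> real"
  assumes "finite I" "\<And>n i. i \<in> I \<Longrightarrow> f n i \<in> {lo i..hi i}"
  shows "\<exists>r l. strict_mono r \<and> (\<forall>i\<in>I. (\<lambda>n. f (r n) i) \<longlonglongrightarrow> l i)"
  using assms
proof (induction I)
  case empty
  show ?case by (intro exI[of _ id]) (simp add: strict_mono_def)
next
  case (insert j I)
  then obtain r l where r: "strict_mono r" "\<forall>i\<in>I. (\<lambda>n. f (r n) i) \<longlonglongrightarrow> l i" by auto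
  have "f (r n) j \<in> {lo j..hi j}" for n using insert.prems by simp
  then obtain x s where s: "strict_mono s" "((\<lambda>n. f (r n) j) \<circ> s) \<longlonglongrightarrow> x"
    using compact_Icc[of "lo j" "hi j", unfolded compact_def, rule_format, of "\<lambda>n. f (r n) j"]
    by blast
  have "(\<lambda>n. f ((r \<circ> s) n) i) \<longlonglongrightarrow> (if i = j then x else l i)" if "i \<in> insert j I" for i
  proof (cases "i = j")
    case True
    then show ?thesis using s(2) by (simp add: comp_def)
  next
    case False
    then have "(\<lambda>n. f (r n) i) \<longlonglongrightarrow> l i" using r that by simp
    from LIMSEQ_subseq_LIMSEQ[OF this s(1)] False show ?thesis by (simp add: comp_def)
  qed
  then show ?case using strict_mono_o[OF r(1) s(1)]
    by (intro exI[of _ "r \<circ> s"] exI[of _ "\<lambda>i. if i = j then x else l i"]) blast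
qed

context cake
begin

lemma piece_len_seg:
  assumes "e \<in> edges G" "a \<in> {0..elen G e}" "b \<in> {0..elen G e}"
  shows "piece_len G (seg e a b) = \<bar>a - b\<bar>"
proof -
  have "measure lborel (edge_part G e' (seg e a b)) = (if e' = e then \<bar>a - b\<bar> else 0)" for e'
    using edge_part_seg[OF assms(2,3), of e'] by (simp add: open_segment_eq_real_ivl abs_if)
  then show ?thesis using assms(1) finite_edges by (simp add: piece_len_def)
qed

text \<open>The open segment and the complement of the closed one are both open, and
  \<open>P\<close> misses the two points that separate them.\<close>

lemma conn_piece_in_seg:
  assumes P: "conn_piece G P" and e: "e \<in> edges G" and yx: "0 < y" "x < elen G e" "y < s" "s < x"
    and "Pt e y \<notin> P" "Pt e x \<notin> P" "Pt e s \<in> P"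
  shows "P \<subseteq> seg e y x"
proof (rule ccontr)
  assume "\<not> P \<subseteq> seg e y x"
  have y: "y \<in> {0..elen G e}" and x: "x \<in> {0..elen G e}" using yx by auto
  have cs: "cseg G e y x = seg e y x \<union> {Pt e y, Pt e x}"
    using cseg_eq[OF y x] yx by (simp add: edge_map_inner)
  have s: "Pt e s \<in> seg e y x" using yx by (auto simp: seg_def open_segment_eq_real_ivl)
  have "openin T (seg e y x)" "openin T (points G - cseg G e y x)"
    using openin_seg[OF e y x] closedin_cseg[OF e y x] by (simp_all add: closedin_def)
  moreover have "connectedin T P" "P \<subseteq> points G"
    using P by (auto simp: conn_piece_def path_connectedin_imp_connectedin is_piece_def)
  moreover have "P \<subseteq> seg e y x \<union> (points G - cseg G e y x)"
    using cs assms \<open>P \<subseteq> points G\<close> by auto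
  moreover have "seg e y x \<inter> (points G - cseg G e y x) \<inter> P = {}" using cs by auto
  moreover have "seg e y x \<inter> P \<noteq> {}" using s assms by blast
  moreover have "(points G - cseg G e y x) \<inter> P \<noteq> {}"
    using \<open>\<not> P \<subseteq> seg e y x\<close> \<open>P \<subseteq> seg e y x \<union> (points G - cseg G e y x)\<close> by blast
  ultimately show False unfolding connectedin by blast
qed

text \<open>If the missing positions do not form an interval, two of them enclose a position of
  \<open>P\<close>, and then all of \<open>P\<close> is trapped between them. A further gap inside
  would trap \<open>P\<close> on one side of that gap, although it has points on both.\<close>

lemma edge_part_conn_piece:
  assumes P: "conn_piece G P" and e: "e \<in> edges G"
  shows "is_interval (edge_part G e P) \<or> is_interval ({0<..<elen G e} - edge_part G e P)"
proof (rule disjCI)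
  let ?A = "edge_part G e P" and ?L = "elen G e"
  assume "\<not> is_interval ({0<..<?L} - ?A)"
  then obtain y z y' where y: "0 < y" "y < ?L" "y \<notin> ?A" and y': "y' < ?L" "y' \<notin> ?A"
    and z: "y \<le> z" "z \<le> y'" "z \<in> ?A"
    unfolding is_interval_1 by auto
  have ne: "y < z" "z < y'" using y y' z by (metis order_le_less)+
  have out: "Pt e t \<notin> P" if "0 < t" "t < ?L" "t \<notin> ?A" for t
    using that by (auto simp: edge_part_def)
  have inn: "Pt e t \<in> P" if "t \<in> ?A" for t using that by (auto simp: edge_part_def)
  have *: "?A \<subseteq> {u<..<w}"
    if "0 < u" "u < t" "t < w" "w < ?L" "u \<notin> ?A" "w \<notin> ?A" "t \<in> ?A" for u t w
  proof -
    have "P \<subseteq> seg e u w"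
      using that conn_piece_in_seg[OF P e _ _ _ _ out out inn, of u w t] by force
    then show ?thesis using that by (force simp: seg_def edge_part_def open_segment_eq_real_ivl)
  qed
  show "is_interval ?A"
    unfolding is_interval_1
  proof (intro ballI allI impI, rule ccontr)
    fix a b x assume ab: "a \<in> ?A" "b \<in> ?A" "a \<le> x \<and> x \<le> b" "x \<notin> ?A"
    have "?A \<subseteq> {y<..<y'}" using * y y' z ne by blast
    then have "y < a" "b < y'" using ab by auto
    moreover have "a < x" "x < b" using ab by (metis order_le_less)+
    ultimately have "?A \<subseteq> {y<..<x}" using *[of y a x] y y' ab by auto
    then show False using ab \<open>x < b\<close> by auto
  qed
qed

text \<open>An interval needs only one of the two intervals, the other being degenerate. If the
  missing part is an interval, what remains on either side of it gives two. Only the membership of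
  the end positions \<open>a\<close> and \<open>b\<close> may come out wrong.\<close>

lemma edge_part_two_intervals:
  assumes P: "conn_piece G P" and e: "e \<in> edges G"
  shows "\<exists>f. (\<forall>i. f i \<in> {0..elen G e}) \<and>
    finite ((edge_part G e P - two_intervals f) \<union> (two_intervals f - edge_part G e P))"
proof -
  let ?A = "edge_part G e P" and ?L = "elen G e"
  have A: "?A \<subseteq> {0<..<?L}" by (auto simp: edge_part_def)
  from edge_part_conn_piece[OF P e] show ?thesis
  proof
    assume "is_interval ?A"
    from is_interval_approx[OF this A elen_pos[OF e]] obtain a b where
      ab: "0 \<le> a" "a \<le> b" "b \<le> ?L" "{a<..<b} \<subseteq> ?A" "?A \<subseteq> {a..b}" by blast
    define f where "f = (\<lambda>i::nat. if i = 0 then a else if i = 1 then b else 0)"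
    have "(?A - two_intervals f) \<union> (two_intervals f - ?A) \<subseteq> {a, b}"
      using ab by (force simp: two_intervals_def f_def)
    moreover have "\<forall>i. f i \<in> {0..?L}" using ab by (auto simp: f_def)
    ultimately show ?thesis by (meson finite.emptyI finite.insertI finite_subset)
  next
    assume "is_interval ({0<..<?L} - ?A)"
    from is_interval_approx[OF this _ elen_pos[OF e]] obtain a b where
      ab: "0 \<le> a" "a \<le> b" "b \<le> ?L" "{a<..<b} \<subseteq> {0<..<?L} - ?A" "{0<..<?L} - ?A \<subseteq> {a..b}" by blast
    define f where "f = (\<lambda>i::nat. if i = 0 then 0 else if i = 1 then a else if i = 2 then b else ?L)"
    have "(?A - two_intervals f) \<union> (two_intervals f - ?A) \<subseteq> {a, b}"
    proof (rule subsetI, rule ccontr)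
      fix x assume x: "x \<in> (?A - two_intervals f) \<union> (two_intervals f - ?A)" "x \<notin> {a, b}"
      have "two_intervals f = {0<..<a} \<union> {b<..<?L}" by (simp add: two_intervals_def f_def)
      then show False
        using x ab subsetD[OF ab(4), of x] subsetD[OF ab(5), of x] subsetD[OF A, of x] by auto
    qed
    moreover have "\<forall>i. f i \<in> {0..?L}" using ab elen_pos[OF e] by (auto simp: f_def)
    ultimately show ?thesis by (meson finite.emptyI finite.insertI finite_subset)
  qed
qed

text \<open>Sequential compactness, modulo null sets, of the family of connected pieces upgrades
  continuity of a valuation at each piece to uniform continuity.\<close>
lemma valuation_uniform:
  assumes v: "valuation G v" and "\<epsilon> > 0"
  shows "\<exists>\<delta>>0. \<forall>P Y. conn_piece G P \<longrightarrow> is_piece G Y \<longrightarrow>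
    piece_len G ((P - Y) \<union> (Y - P)) < \<delta> \<longrightarrow> \<bar>v P - v Y\<bar> < \<epsilon>"
proof (rule ccontr)
  assume "\<not> ?thesis"
  then have "\<forall>n. \<exists>P Y. conn_piece G P \<and> is_piece G Y \<and>
    piece_len G ((P - Y) \<union> (Y - P)) < inverse (real (Suc n)) \<and> \<not> \<bar>v P - v Y\<bar> < \<epsilon>"
    by (metis inverse_positive_iff_positive of_nat_0_less_iff zero_less_Suc)
  then obtain P Y where PY: "\<And>n. conn_piece G (P n)" "\<And>n. is_piece G (Y n)"
    "\<And>n. piece_len G ((P n - Y n) \<union> (Y n - P n)) < inverse (real (Suc n))"
    "\<And>n. \<not> \<bar>v (P n) - v (Y n)\<bar> < \<epsilon>" by metis
  have Pp: "is_piece G (P n)" for n using PY(1) by (simp add: conn_piece_def)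
  have "\<forall>n. \<forall>e\<in>edges G. \<exists>f. (\<forall>i. f i \<in> {0..elen G e}) \<and>
    finite ((edge_part G e (P n) - two_intervals f) \<union> (two_intervals f - edge_part G e (P n)))"
    using edge_part_two_intervals PY(1) by blast
  then obtain f where f: "\<And>n e i. e \<in> edges G \<Longrightarrow> f n e i \<in> {0..elen G e}"
    "\<And>n e. e \<in> edges G \<Longrightarrow> finite ((edge_part G e (P n) - two_intervals (f n e)) \<union>
        (two_intervals (f n e) - edge_part G e (P n)))"
    by metis
  \<comment> \<open>There are finitely many coordinates, four on each edge, and each stays in the
    compact interval from 0 to the length of the edge.\<close>
  have "\<exists>r l. strict_mono r \<and> (\<forall>i\<in>edges G \<times> {..<4}. (\<lambda>n. case i of (e, k) \<Rightarrow> f (r n) e k) \<longlonglongrightarrow> l i)"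
    by (rule convergent_subsequence_finite[where lo = "\<lambda>_. 0" and hi = "\<lambda>(e, k). elen G e"])
      (use f(1) finite_edges in auto)
  then obtain r l' where r: "strict_mono r"
    and l': "\<And>e k. e \<in> edges G \<Longrightarrow> k < 4 \<Longrightarrow> (\<lambda>n. f (r n) e k) \<longlonglongrightarrow> l' (e, k)"
    by fastforce
  define l where "l e k = l' (e, k)" for e k
  have l: "(\<lambda>n. f (r n) e k) \<longlonglongrightarrow> l e k" if "e \<in> edges G" "k < 4" for e k
    using l' that by (simp add: l_def)
  have lr: "l e k \<in> {0..elen G e}" if "e \<in> edges G" "k < 4" for e k
    using closed_sequentially[OF closed_atLeastAtMost _ l[OF that], of 0 "elen G e"] f(1) that by blast
  \<comment> \<open>The limit set need not be connected. This does no harm, since a valuation is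
    continuous at every piece, connected or not.\<close>
  define Z :: "('v, 'e) pt set" where "Z = (\<Union>e\<in>edges G. Pt e ` two_intervals (l e))"
  have ti: "two_intervals (l e) \<subseteq> {0<..<elen G e}" if "e \<in> edges G" for e
    using lr[OF that, of 0] lr[OF that, of 1] lr[OF that, of 2] lr[OF that, of 3]
    by (auto simp: two_intervals_def)
  have eZ: "edge_part G e Z = two_intervals (l e)" if "e \<in> edges G" for e
    using that ti[OF that] by (auto simp: edge_part_def Z_def)
  have Zp: "is_piece G Z"
  proof -
    have "fin_intervals (two_intervals (l e))" for e
      unfolding two_intervals_def by (intro fin_intervals_Un fin_intervals_interval) auto
    moreover have "Z \<subseteq> points G" using ti by (fastforce simp: Z_def points_def)
    ultimately show ?thesis by (simp add: is_piece_iff eZ)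
  qed
  let ?d = "\<lambda>A B. piece_len G ((A - B) \<union> (B - A))"
  have dP: "(\<lambda>n. ?d Z (P (r n))) \<longlonglongrightarrow> 0"
  proof (rule tendsto_sandwich[of "\<lambda>_. 0"])
    have "?d Z (P (r n)) \<le> (\<Sum>e\<in>edges G. \<Sum>i<4. \<bar>f (r n) e i - l e i\<bar>)" for n
      unfolding piece_len_def
    proof (rule sum_mono)
      fix e assume e: "e \<in> edges G"
      have "edge_part G e ((Z - P (r n)) \<union> (P (r n) - Z)) =
         (edge_part G e (P (r n)) - two_intervals (l e)) \<union> (two_intervals (l e) - edge_part G e (P (r n)))"
        by (auto simp: edge_part_Un edge_part_Diff eZ[OF e])
      moreover have "edge_part G e (P (r n)) \<in> sets borel"
        using Pp e by (auto simp: is_piece_iff fin_intervals_borel)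
      ultimately show "measure lborel (edge_part G e ((Z - P (r n)) \<union> (P (r n) - Z)))
          \<le> (\<Sum>i<4. \<bar>f (r n) e i - l e i\<bar>)"
        using two_intervals_sdiff[OF f(2)[OF e]] by simp
    qed
    then show "\<forall>\<^sub>F n in sequentially. ?d Z (P (r n)) \<le> (\<Sum>e\<in>edges G. \<Sum>i<4. \<bar>f (r n) e i - l e i\<bar>)"
      by simp
    show "\<forall>\<^sub>F n in sequentially. 0 \<le> ?d Z (P (r n))" by (simp add: piece_len_def sum_nonneg)
    have "(\<lambda>n. \<bar>f (r n) e i - l e i\<bar>) \<longlonglongrightarrow> 0" if "e \<in> edges G" "i < 4" for e i
      using tendsto_rabs[OF LIM_zero[OF l[OF that]]] by simp
    then have "(\<lambda>n. \<Sum>e\<in>edges G. \<Sum>i<4. \<bar>f (r n) e i - l e i\<bar>) \<longlonglongrightarrow> (\<Sum>e\<in>edges G. \<Sum>i<4::nat. 0)"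
      by (intro tendsto_sum) simp
    then show "(\<lambda>n. \<Sum>e\<in>edges G. \<Sum>i<4. \<bar>f (r n) e i - l e i\<bar>) \<longlonglongrightarrow> 0" by simp
  qed simp
  \<comment> \<open>Along the subsequence \<open>P\<close> is within \<open>\<delta> / 2\<close> of
    \<open>Z\<close>, and \<open>Y\<close> is within \<open>\<delta> / 2\<close> of
    \<open>P\<close>. So continuity at \<open>Z\<close> alone brings both values within
    \<open>\<epsilon> / 2\<close> of \<open>v Z\<close>, contradicting the choice of the
    pair.\<close>
  have "0 < \<epsilon> / 2" using assms(2) by simp
  then obtain \<delta> where \<delta>: "\<delta> > 0" "\<And>Y. is_piece G Y \<Longrightarrow> ?d Z Y < \<delta> \<Longrightarrow> \<bar>v Z - v Y\<bar> < \<epsilon> / 2"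
    using v Zp unfolding valuation_def by metis
  have "\<forall>\<^sub>F n in sequentially. ?d Z (P (r n)) < \<delta> / 2"
    by (rule order_tendstoD(2)[OF dP]) (use \<delta> in simp)
  moreover have "\<forall>\<^sub>F n in sequentially. inverse (real (Suc n)) < \<delta> / 2"
    by (rule order_tendstoD(2)[OF LIMSEQ_inverse_real_of_nat]) (use \<delta> in simp)
  ultimately have "\<forall>\<^sub>F n in sequentially. ?d Z (P (r n)) < \<delta> / 2 \<and> inverse (real (Suc n)) < \<delta> / 2"
    by (rule eventually_conj)
  then obtain n where n: "?d Z (P (r n)) < \<delta> / 2" "inverse (real (Suc n)) < \<delta> / 2"
    by (metis (no_types, lifting) eventually_sequentially order_refl)
  have "inverse (real (Suc (r n))) \<le> inverse (real (Suc n))"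
    using seq_suble[OF r, of n] by (simp add: le_imp_inverse_le)
  then have dY: "?d (P (r n)) (Y (r n)) < \<delta> / 2" using PY(3)[of "r n"] n by linarith
  have "?d Z (Y (r n)) \<le> piece_len G (((Z - P (r n)) \<union> (P (r n) - Z)) \<union>
      ((P (r n) - Y (r n)) \<union> (Y (r n) - P (r n))))"
    by (rule piece_len_mono) (use Zp Pp PY(2) in \<open>auto intro!: is_piece_Un is_piece_Diff\<close>)
  also have "\<dots> \<le> ?d Z (P (r n)) + ?d (P (r n)) (Y (r n))"
    by (rule piece_len_Un) (use Zp Pp PY(2) in \<open>auto intro!: is_piece_Un is_piece_Diff\<close>)
  finally have "?d Z (Y (r n)) < \<delta>" using n dY by linarith
  then have "\<bar>v Z - v (Y (r n))\<bar> < \<epsilon> / 2" using \<delta>(2) PY(2) by blast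
  moreover have "\<bar>v Z - v (P (r n))\<bar> < \<epsilon> / 2" using \<delta> Pp n by force
  ultimately show False using PY(4)[of "r n"] by linarith
qed

end

text \<open>Choosing in each such set one of its points of \<open>Z\<close> is injective by
  disjointness.\<close>

lemma card_meeting_le:
  assumes "finite I" "finite Z" "\<And>i j. i \<in> I \<Longrightarrow> j \<in> I \<Longrightarrow> i \<noteq> j \<Longrightarrow> P i \<inter> P j = {}"
  shows "card {i \<in> I. P i \<inter> Z \<noteq> {}} \<le> card Z"
proof -
  have "\<forall>i\<in>{i \<in> I. P i \<inter> Z \<noteq> {}}. \<exists>z. z \<in> P i \<inter> Z" by blast
  then obtain f where f: "\<And>i. i \<in> I \<Longrightarrow> P i \<inter> Z \<noteq> {} \<Longrightarrow> f i \<in> P i \<inter> Z"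
    by (metis (mono_tags, lifting) mem_Collect_eq)
  have "inj_on f {i \<in> I. P i \<inter> Z \<noteq> {}}"
  proof (rule inj_onI, rule ccontr)
    fix i j assume ij: "i \<in> {i \<in> I. P i \<inter> Z \<noteq> {}}" "j \<in> {i \<in> I. P i \<inter> Z \<noteq> {}}" "f i = f j" "i \<noteq> j"
    then have "P i \<inter> P j = {}" by (intro assms(3)) auto
    with f[of i] f[of j] ij show False by auto
  qed
  then show ?thesis using f assms by (intro card_inj_on_le[of f]) auto
qed

context cake
begin

section \<open>Cutting off a piece\<close>

text \<open>An arbitrary finite index set takes the place of an initial segment of
  \<open>nat\<close>, so that pieces can be given up without renumbering the others.\<close>

definition splits :: "(('v, 'e) pt set \<Rightarrow> real) \<Rightarrow> ('v, 'e) pt set \<Rightarrow> real \<Rightarrow> nat \<Rightarrow> bool" where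
  "splits u R c k \<longleftrightarrow> (\<exists>(I :: nat set) P. finite I \<and> k \<le> card I \<and>
     (\<forall>i\<in>I. conn_piece G (P i) \<and> P i \<subseteq> R \<and> c \<le> u (P i)) \<and>
     (\<forall>i\<in>I. \<forall>j\<in>I. i \<noteq> j \<longrightarrow> P i \<inter> P j = {}))"

definition splittable :: "(('v, 'e) pt set \<Rightarrow> real) \<Rightarrow> ('v, 'e) pt set \<Rightarrow> real \<Rightarrow> nat \<Rightarrow> bool" where
  "splittable u R m k \<longleftrightarrow> (\<forall>c<m. splits u R c k)"

lemma valuation_mono: "valuation G u \<Longrightarrow> is_piece G X \<Longrightarrow> is_piece G Y \<Longrightarrow> X \<subseteq> Y \<Longrightarrow> u X \<le> u Y"
  by (simp add: valuation_def)

text \<open>Pieces that meet \<open>Z\<close> are given up, at a cost of at most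
  \<open>card Z\<close>; all others keep their index and are trimmed by \<open>X\<close>.\<close>

lemma splits_trim:
  assumes "splits u R c k" "finite Z"
    and trim: "\<And>P. \<lbrakk>conn_piece G P; P \<subseteq> R; c \<le> u P; P \<inter> Z = {}\<rbrakk> \<Longrightarrow>
        conn_piece G (P - X) \<and> c' \<le> u (P - X)"
  shows "splits u (R - X) c' (k - card Z)"
proof -
  obtain I :: "nat set" and P where IP: "finite I \<and> k \<le> card I \<and>
     (\<forall>i\<in>I. conn_piece G (P i) \<and> P i \<subseteq> R \<and> c \<le> u (P i)) \<and>
     (\<forall>i\<in>I. \<forall>j\<in>I. i \<noteq> j \<longrightarrow> P i \<inter> P j = {})"
    using assms(1) unfolding splits_def by (elim exE)
  have I: "finite I" "k \<le> card I"
    "\<And>i. i \<in> I \<Longrightarrow> conn_piece G (P i) \<and> P i \<subseteq> R \<and> c \<le> u (P i)"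
    "\<And>i j. i \<in> I \<Longrightarrow> j \<in> I \<Longrightarrow> i \<noteq> j \<Longrightarrow> P i \<inter> P j = {}"
    using IP by simp_all
  let ?B = "{i \<in> I. P i \<inter> Z \<noteq> {}}"
  have "card (I - ?B) = card I - card ?B" using I(1) by (intro card_Diff_subset) auto
  then have "k - card Z \<le> card (I - ?B)"
    using card_meeting_le[OF I(1) assms(2), of P] I(2,4) by fastforce
  moreover have "conn_piece G (P i - X) \<and> P i - X \<subseteq> R - X \<and> c' \<le> u (P i - X)" if "i \<in> I - ?B" for i
    using I(3)[of i] trim[of "P i"] that by auto
  moreover have "(P i - X) \<inter> (P j - X) = {}" if "i \<in> I - ?B" "j \<in> I - ?B" "i \<noteq> j" for i j
    using I(4)[of i j] that by blast
  ultimately show ?thesis unfolding splits_def using I(1)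
    by (intro exI[of _ "I - ?B"] exI[of _ "\<lambda>i. P i - X"]) simp
qed

text \<open>The demand \<open>c'\<close> is raised above \<open>c0\<close> while staying below
  \<open>m\<close>. A piece worth that much either meets \<open>Z\<close>, and is charged to it, or
  is disjoint from \<open>X\<close> and survives untouched.\<close>

lemma splittable_remove:
  assumes "splittable u R m k" "finite Z" "c0 < m"
    and "\<And>P. \<lbrakk>conn_piece G P; P \<subseteq> R; P \<inter> X \<noteq> {}; P \<inter> Z = {}\<rbrakk> \<Longrightarrow> u P \<le> c0"
  shows "splittable u (R - X) m (k - card Z)"
  unfolding splittable_def
proof (intro allI impI)
  fix c assume "c < m"
  define c' where "c' = max c ((c0 + m) / 2)"
  have c': "c' < m" "c0 < c'" "c \<le> c'" using \<open>c < m\<close> assms(3) by (auto simp: c'_def max_def)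
  have "splits u R c' k" using assms(1) c' by (simp add: splittable_def)
  from this assms(2) show "splits u (R - X) c (k - card Z)"
  proof (rule splits_trim)
    fix P assume P: "conn_piece G P" "P \<subseteq> R" "c' \<le> u P" "P \<inter> Z = {}"
    then have "P \<inter> X = {}" using assms(4)[of P] c' by force
    then have "P - X = P" by blast
    then show "conn_piece G (P - X) \<and> c \<le> u (P - X)" using P c' by simp
  qed
qed

lemma splits_mono:
  assumes "splits u R c k" "R \<subseteq> R'"
  shows "splits u R' c k"
proof -
  obtain I :: "nat set" and P where "finite I" "k \<le> card I"
    and P: "\<forall>i\<in>I. conn_piece G (P i) \<and> P i \<subseteq> R \<and> c \<le> u (P i)"
    and "\<forall>i\<in>I. \<forall>j\<in>I. i \<noteq> j \<longrightarrow> P i \<inter> P j = {}"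
    using assms(1) unfolding splits_def by (elim exE conjE)
  moreover have "\<forall>i\<in>I. conn_piece G (P i) \<and> P i \<subseteq> R' \<and> c \<le> u (P i)"
    using P assms(2) by (meson subset_trans)
  ultimately show ?thesis unfolding splits_def by (intro exI[of _ I] exI[of _ P]) simp
qed

lemma splittable_mono: "splittable u R m k \<Longrightarrow> R \<subseteq> R' \<Longrightarrow> splittable u R' m k"
  unfolding splittable_def using splits_mono by blast

text \<open>A piece that avoids q is disjoint from Y, hence loses at most the thin set X - Y when X is
  removed. The slack between c and m pays for this loss uniformly.\<close>
lemma splittable_cut:
  assumes u: "valuation G u" and "splittable u R m k"
    and thin: "\<And>\<delta>. \<delta> > 0 \<Longrightarrow> \<exists>X p Y q. gate R X p \<and> is_piece G X \<and> D \<subseteq> X \<and>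
      gate R Y q \<and> is_piece G Y \<and> u Y < m \<and> piece_len G (X - Y) < \<delta>"
  shows "splittable u (R - D) m (k - 1)"
  unfolding splittable_def
proof (intro allI impI)
  fix c assume "c < m"
  define \<epsilon> where "\<epsilon> = (m - c) / 2"
  have \<epsilon>: "\<epsilon> > 0" using \<open>c < m\<close> by (simp add: \<epsilon>_def)
  obtain \<delta> where \<delta>: "\<delta> > 0" "\<And>P Y. conn_piece G P \<Longrightarrow> is_piece G Y \<Longrightarrow>
      piece_len G ((P - Y) \<union> (Y - P)) < \<delta> \<Longrightarrow> \<bar>u P - u Y\<bar> < \<epsilon>"
    using valuation_uniform[OF u \<epsilon>] by blast
  obtain X p Y q where X: "gate R X p" "is_piece G X" "D \<subseteq> X"
    and Y: "gate R Y q" "is_piece G Y" "u Y < m" "piece_len G (X - Y) < \<delta>"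
    using thin[OF \<delta>(1)] by blast
  \<comment> \<open>A demand above \<open>u Y\<close> keeps every chosen piece from fitting into
    \<open>Y\<close>, and the surplus \<open>\<epsilon>\<close> over \<open>c\<close> pays for what
    is trimmed. As \<open>\<epsilon>\<close> is half the gap between \<open>c\<close> and
    \<open>m\<close>, both requirements stay below \<open>m\<close>.\<close>
  define c' where "c' = max (c + \<epsilon>) ((u Y + m) / 2)"
  have c': "c' < m" "u Y < c'" "c + \<epsilon> \<le> c'"
    using \<open>c < m\<close> Y(3) by (auto simp: c'_def \<epsilon>_def max_def field_simps)
  have "splits u R c' k" using assms(2) c' by (simp add: splittable_def)
  then have "splits u (R - X) c (k - card {q})"
  proof (rule splits_trim)
    fix P assume P: "conn_piece G P" "P \<subseteq> R" "c' \<le> u P" "P \<inter> {q} = {}"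
    have PX: "conn_piece G (P - X)" using conn_piece_trim[OF X(1) P(1,2) X(2)] .
    have Pp: "is_piece G P" "path_connectedin T P" using P by (auto simp: conn_piece_def)
    have "\<not> P \<subseteq> Y" using valuation_mono[OF u Pp(1) Y(2)] P(3) c' by force
    then have "P \<inter> Y = {}" using gate_avoid[OF Y(1) Pp(2) P(2)] P(4) by blast
    then have "(P - (P - X)) \<union> ((P - X) - P) \<subseteq> X - Y" by blast
    then have "piece_len G ((P - (P - X)) \<union> ((P - X) - P)) \<le> piece_len G (X - Y)"
      using Pp(1) X(2) Y(2) by (intro piece_len_mono is_piece_Un is_piece_Diff)
    then have "\<bar>u P - u (P - X)\<bar> < \<epsilon>"
      using Y(4) P(1) PX by (intro \<delta>(2)) (auto simp: conn_piece_def)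
    then show "conn_piece G (P - X) \<and> c \<le> u (P - X)" using PX P(3) c' by linarith
  qed simp
  moreover have "R - X \<subseteq> R - D" using X(3) by blast
  ultimately show "splits u (R - D) c (k - 1)" using splits_mono by simp
qed

section \<open>Partially processed forests\<close>

definition region where
  "region F W K = (\<Union>w\<in>W. K w) \<union> (\<Union>(e, a, b)\<in>F. seg e a b)"

text \<open>A triple (e, a, b) in F is the part of e strictly between the positions a and b, traversed
  from a to b. Each of its ends is either a live vertex (one in W) or lies outside the region; the
  bag of a live vertex w consists of w and of the branches that have been absorbed into w.\<close>
definition stage where
  "stage F W K \<longleftrightarrow> finite F \<and> finite W \<and> W \<subseteq> verts G \<and> inj_on fst F \<and>
    (\<forall>e a b. (e, a, b) \<in> F \<longrightarrow> e \<in> edges G \<and> a \<in> {0..elen G e} \<and> b \<in> {0..elen G e} \<and> a \<noteq> b \<and>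
       (edge_map G e a \<in> Vtx ` W \<or> edge_map G e a \<notin> region F W K) \<and>
       (edge_map G e b \<in> Vtx ` W \<or> edge_map G e b \<notin> region F W K) \<and>
       (\<forall>w\<in>W. K w \<inter> seg e a b = {})) \<and>
    (\<forall>w\<in>W. Vtx w \<in> K w \<and> conn_piece G (K w) \<and> closedin (subtopology T (region F W K)) (K w) \<and>
       (\<forall>w'\<in>W. w \<noteq> w' \<longrightarrow> K w \<inter> K w' = {}))"

lemma stageI:
  assumes "finite F" "finite W" "W \<subseteq> verts G" "inj_on fst F"
    "\<And>e a b. (e, a, b) \<in> F \<Longrightarrow> e \<in> edges G \<and> a \<in> {0..elen G e} \<and> b \<in> {0..elen G e} \<and> a \<noteq> b"
    "\<And>e a b. (e, a, b) \<in> F \<Longrightarrow> (edge_map G e a \<in> Vtx ` W \<or> edge_map G e a \<notin> region F W K) \<and>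
       (edge_map G e b \<in> Vtx ` W \<or> edge_map G e b \<notin> region F W K)"
    "\<And>e a b w. (e, a, b) \<in> F \<Longrightarrow> w \<in> W \<Longrightarrow> K w \<inter> seg e a b = {}"
    "\<And>w. w \<in> W \<Longrightarrow> Vtx w \<in> K w \<and> conn_piece G (K w)"
    "\<And>w. w \<in> W \<Longrightarrow> closedin (subtopology T (region F W K)) (K w)"
    "\<And>w w'. w \<in> W \<Longrightarrow> w' \<in> W \<Longrightarrow> w \<noteq> w' \<Longrightarrow> K w \<inter> K w' = {}"
  shows "stage F W K"
  unfolding stage_def using assms by blast

lemma stage_arc:
  assumes "stage F W K" "(e, a, b) \<in> F"
  shows "e \<in> edges G" "a \<in> {0..elen G e}" "b \<in> {0..elen G e}" "a \<noteq> b"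
    "edge_map G e a \<in> Vtx ` W \<or> edge_map G e a \<notin> region F W K"
    "edge_map G e b \<in> Vtx ` W \<or> edge_map G e b \<notin> region F W K"
    "w \<in> W \<Longrightarrow> K w \<inter> seg e a b = {}"
  using assms unfolding stage_def by blast+

lemma stage_vertex:
  assumes "stage F W K" "w \<in> W"
  shows "Vtx w \<in> K w" "conn_piece G (K w)" "closedin (subtopology T (region F W K)) (K w)"
    "w' \<in> W \<Longrightarrow> w \<noteq> w' \<Longrightarrow> K w \<inter> K w' = {}" "w \<in> verts G"
  using assms unfolding stage_def by blast+

lemma stage_finite: "stage F W K \<Longrightarrow> finite F" "stage F W K \<Longrightarrow> finite W"
  by (simp_all add: stage_def)

text \<open>Injectivity of \<open>fst\<close> on \<open>F\<close> leaves at most one arc on each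
  edge; this is kept up because a cut hands out one side of the cut point and retains the
  other.\<close>

lemma seg_disjoint:
  assumes "stage F W K" "(e, a, b) \<in> F" "(e', a', b') \<in> F" "(e, a, b) \<noteq> (e', a', b')"
  shows "seg e a b \<inter> seg e' a' b' = {}"
proof -
  have "e \<noteq> e'" using assms unfolding stage_def inj_on_def by (metis fst_conv)
  then show ?thesis by (auto simp: seg_def)
qed

lemma closedin_subtopology_subset:
  assumes "closedin (subtopology T R) C" "C \<subseteq> R'" "R' \<subseteq> R"
  shows "closedin (subtopology T R') C"
  using assms unfolding closedin_subtopology by blast

lemma region_mono: "F' \<subseteq> F \<Longrightarrow> W' \<subseteq> W \<Longrightarrow> region F' W' K \<subseteq> region F W K"
  unfolding region_def by blast

lemma region_is_piece:
  assumes "stage F W K"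
  shows "is_piece G (region F W K)"
proof -
  have "is_piece G (\<Union>A)" if "finite A" "\<And>X. X \<in> A \<Longrightarrow> is_piece G X" for A :: "('v, 'e) pt set set"
    using that by (induction A) (auto intro: is_piece_Un)
  note * = this
  have "is_piece G (\<Union>w\<in>W. K w)"
    by (rule *) (use stage_finite[OF assms] stage_vertex(2)[OF assms] in \<open>auto simp: conn_piece_def\<close>)
  moreover have "is_piece G (\<Union>(e, a, b)\<in>F. seg e a b)"
    by (rule *) (use stage_finite[OF assms] stage_arc(1-3)[OF assms] is_piece_seg in \<open>fastforce+\<close>)
  ultimately show ?thesis unfolding region_def by (rule is_piece_Un)
qed

lemma region_Diff:
  assumes s: "stage F W K" and "F0 \<subseteq> F" "W0 \<subseteq> W"
  shows "region F W K - region F0 W0 K = region (F - F0) (W - W0) K"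
proof -
  have "region F0 W0 K \<inter> region (F - F0) (W - W0) K = {}"
  proof (rule equals0I)
    fix x assume "x \<in> region F0 W0 K \<inter> region (F - F0) (W - W0) K"
    then consider w w' where "w \<in> W0" "w' \<in> W - W0" "x \<in> K w" "x \<in> K w'"
      | w e a b where "w \<in> W" "(e, a, b) \<in> F" "x \<in> K w" "x \<in> seg e a b"
      | e a b e' a' b' where "(e, a, b) \<in> F0" "(e', a', b') \<in> F - F0" "x \<in> seg e a b" "x \<in> seg e' a' b'"
      using assms(2,3) unfolding region_def by blast
    then show False
    proof cases
      case 1
      then show False using stage_vertex(4)[OF s, of w w'] assms(3) by blast
    next
      case 2
      then show False using stage_arc(7)[OF s] by blast
    next
      case 3
      then have "(e, a, b) \<noteq> (e', a', b')" by auto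
      with 3 show False using seg_disjoint[OF s, of e a b e' a' b'] assms(2) by blast
    qed
  qed
  moreover have "region F W K = region F0 W0 K \<union> region (F - F0) (W - W0) K"
    using assms(2,3) unfolding region_def by blast
  ultimately show ?thesis by blast
qed

text \<open>Closing an arc adds only its ends, and an end that belongs to the region is a live
  vertex, contained in its own bag.\<close>

lemma region_cseg:
  assumes s: "stage F W K" and "(e, a, b) \<in> F"
  shows "region F W K \<inter> cseg G e a b \<subseteq> seg e a b \<union> (\<Union>w\<in>{w\<in>W. Vtx w \<in> {edge_map G e a, edge_map G e b}}. K w)"
  using cseg_eq[of a G e b] stage_arc[OF assms] stage_vertex(1)[OF s] by auto

text \<open>An arc is in general not relatively closed, but its closed segment has a relatively
  closed trace, which exceeds the arc only inside bags at its live ends. If no remaining arc ends at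
  a removed vertex, these bags remain too, and the remainder is a finite union of relatively closed
  sets.\<close>

lemma closedin_rest:
  assumes s: "stage F W K" and "F0 \<subseteq> F" "W0 \<subseteq> W"
    and ends: "\<And>e a b. (e, a, b) \<in> F - F0 \<Longrightarrow> edge_map G e a \<notin> Vtx ` W0 \<and> edge_map G e b \<notin> Vtx ` W0"
  shows "closedin (subtopology T (region F W K)) (region (F - F0) (W - W0) K)"
proof -
  let ?R = "region F W K"
  let ?A = "(\<Union>w\<in>W - W0. K w) \<union> (\<Union>\<alpha>\<in>F - F0. ?R \<inter> (case \<alpha> of (e, a, b) \<Rightarrow> cseg G e a b))"
  have c1: "closedin (subtopology T ?R) (\<Union>w\<in>W - W0. K w)"
    using stage_finite[OF s] stage_vertex(3)[OF s] by (intro closedin_Union) auto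
  have "closedin (subtopology T ?R) (?R \<inter> (case \<alpha> of (e, a, b) \<Rightarrow> cseg G e a b))" if "\<alpha> \<in> F" for \<alpha>
  proof -
    obtain e a b where \<alpha>: "\<alpha> = (e, a, b)" by (cases \<alpha>)
    have "closedin T (cseg G e a b)" using stage_arc[OF s, of e a b] that \<alpha> by (intro closedin_cseg) auto
    then show ?thesis using \<alpha> by (simp add: closedin_subtopology_Int_closed)
  qed
  then have c2: "closedin (subtopology T ?R) (\<Union>\<alpha>\<in>F - F0. ?R \<inter> (case \<alpha> of (e, a, b) \<Rightarrow> cseg G e a b))"
    using stage_finite[OF s] by (intro closedin_Union) auto
  have "?A = region (F - F0) (W - W0) K"
  proof (rule subset_antisym)
    show "?A \<subseteq> region (F - F0) (W - W0) K"
    proof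
      fix x assume "x \<in> ?A"
      then consider w where "w \<in> W - W0" "x \<in> K w"
        | e a b where "(e, a, b) \<in> F - F0" "x \<in> ?R \<inter> cseg G e a b" by auto
      then show "x \<in> region (F - F0) (W - W0) K"
      proof cases
        case 1
        then show ?thesis by (auto simp: region_def)
      next
        case 2
        then have "x \<in> seg e a b \<or> (\<exists>w\<in>W. Vtx w \<in> {edge_map G e a, edge_map G e b} \<and> x \<in> K w)"
          using region_cseg[OF s, of e a b] by blast
        moreover have "w \<notin> W0" if "Vtx w \<in> {edge_map G e a, edge_map G e b}" for w
          using ends[OF 2(1)] that by (metis imageI insertE singletonD)
        ultimately show ?thesis using 2(1) unfolding region_def by blast
      qed
    qed
    show "region (F - F0) (W - W0) K \<subseteq> ?A"
    proof
      fix x assume x: "x \<in> region (F - F0) (W - W0) K"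
      have xR: "x \<in> ?R" using x region_mono[of "F - F0" F "W - W0" W K] by blast
      from x consider w where "w \<in> W - W0" "x \<in> K w" | e a b where "(e, a, b) \<in> F - F0" "x \<in> seg e a b"
        unfolding region_def by blast
      then show "x \<in> ?A"
      proof cases
        case 2
        then have "x \<in> cseg G e a b" using cseg_eq[of a G e b] stage_arc[OF s, of e a b] by auto
        then show ?thesis using 2 xR by blast
      qed blast
    qed
  qed
  with closedin_Un[OF c1 c2] show ?thesis by simp
qed

lemma region_points: "stage F W K \<Longrightarrow> region F W K \<subseteq> points G"
  using region_is_piece by (auto simp: is_piece_def)

lemma openin_region:
  assumes s: "stage F W K" and "F0 \<subseteq> F" "W0 \<subseteq> W"
    and "\<And>e a b. (e, a, b) \<in> F - F0 \<Longrightarrow> edge_map G e a \<notin> Vtx ` W0 \<and> edge_map G e b \<notin> Vtx ` W0"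
  shows "openin (subtopology T (region F W K)) (region F0 W0 K)"
proof -
  have ts: "topspace (subtopology T (region F W K)) = region F W K"
    using region_points[OF s] by auto
  have "region F W K - region (F - F0) (W - W0) K = region F0 W0 K"
    using region_Diff[OF assms(1-3)] region_mono[OF assms(2,3)] by blast
  then show ?thesis using closedin_rest[OF assms] ts by (metis openin_diff openin_topspace)
qed

text \<open>A dropped vertex leaves the region together with its bag, so an arc that ended there now
  has an end outside the region, which \<open>stage\<close> permits.\<close>

lemma stage_restrict:
  assumes s: "stage F W K" and F': "F' \<subseteq> F" and W': "W' \<subseteq> W"
  shows "stage F' W' K"
proof -
  have sub: "region F' W' K \<subseteq> region F W K" using region_mono[OF F' W'] .
  have "p \<in> Vtx ` W' \<or> p \<notin> region F' W' K" if p: "p \<in> Vtx ` W \<or> p \<notin> region F W K" for p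
  proof (rule ccontr)
    assume *: "\<not> ?thesis"
    then obtain w where w: "p = Vtx w" "w \<in> W - W'" using p sub by blast
    then have "p \<in> region (F - F') (W - W') K"
      using stage_vertex(1)[OF s] by (auto simp: region_def)
    then show False using region_Diff[OF s F' W'] * by blast
  qed
  note ends = this
  show ?thesis
  proof (rule stageI)
    show "finite F'" "finite W'" using F' W' stage_finite[OF s] finite_subset by auto
    show "inj_on fst F'" "W' \<subseteq> verts G" using s F' W' inj_on_subset unfolding stage_def by blast+
  next
    fix e a b assume "(e, a, b) \<in> F'"
    then have \<alpha>: "(e, a, b) \<in> F" using F' by blast
    show "e \<in> edges G \<and> a \<in> {0..elen G e} \<and> b \<in> {0..elen G e} \<and> a \<noteq> b"
      using stage_arc(1-4)[OF s \<alpha>] by blast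
    show "(edge_map G e a \<in> Vtx ` W' \<or> edge_map G e a \<notin> region F' W' K) \<and>
      (edge_map G e b \<in> Vtx ` W' \<or> edge_map G e b \<notin> region F' W' K)"
      using ends stage_arc(5,6)[OF s \<alpha>] by blast
    fix w assume "w \<in> W'"
    then show "K w \<inter> seg e a b = {}" using stage_arc(7)[OF s \<alpha>] W' by blast
  next
    fix w assume "w \<in> W'"
    then have w: "w \<in> W" "K w \<subseteq> region F' W' K" using W' by (auto simp: region_def)
    show "Vtx w \<in> K w \<and> conn_piece G (K w)" using stage_vertex(1,2)[OF s w(1)] by blast
    show "closedin (subtopology T (region F' W' K)) (K w)"
      using closedin_subtopology_subset[OF stage_vertex(3)[OF s w(1)] w(2) sub] .
  next
    fix w w' assume "w \<in> W'" "w' \<in> W'" "w \<noteq> w'"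
    then show "K w \<inter> K w' = {}" using stage_vertex(4)[OF s] W' by blast
  qed
qed

lemma region_insert: "region (insert (e, a, b) F) W K = region F W K \<union> seg e a b"
  by (auto simp: region_def)

lemma region_swap:
  assumes "(e, a, b) \<in> F"
  shows "region (insert (e, b, a) (F - {(e, a, b)})) W K = region F W K"
proof -
  have "insert (e, a, b) (F - {(e, a, b)}) = F" using assms by blast
  then show ?thesis by (metis region_insert seg_commute)
qed

text \<open>Reorientation allows the leaf end of an arc always to be listed first.\<close>

lemma stage_swap:
  assumes s: "stage F W K" and \<alpha>: "(e, a, b) \<in> F"
  shows "stage (insert (e, b, a) (F - {(e, a, b)})) W K" (is "stage ?F W K")
proof (rule stageI, unfold region_swap[OF \<alpha>])
  have "inj_on fst F" using s by (simp add: stage_def)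
  then show "inj_on fst ?F" using \<alpha> by (force simp: inj_on_def)
  show "finite ?F" "finite W" "W \<subseteq> verts G" using s by (auto simp: stage_def)
next
  fix e' a' b' assume "(e', a', b') \<in> ?F"
  then consider "(e', b', a') \<in> F" | "(e', a', b') \<in> F" using \<alpha> by blast
  note cases = this
  then show "e' \<in> edges G \<and> a' \<in> {0..elen G e'} \<and> b' \<in> {0..elen G e'} \<and> a' \<noteq> b'"
    by cases (use stage_arc(1-4)[OF s] in metis)+
  show "(edge_map G e' a' \<in> Vtx ` W \<or> edge_map G e' a' \<notin> region F W K) \<and>
      (edge_map G e' b' \<in> Vtx ` W \<or> edge_map G e' b' \<notin> region F W K)"
    using cases by cases (use stage_arc(5,6)[OF s] in metis)+
  fix w assume "w \<in> W"
  then show "K w \<inter> seg e' a' b' = {}"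
    using cases stage_arc(7)[OF s] seg_commute by metis
next
  fix w assume w: "w \<in> W"
  show "Vtx w \<in> K w \<and> conn_piece G (K w)" using stage_vertex(1,2)[OF s w] by blast
  show "closedin (subtopology T (region F W K)) (K w)" using stage_vertex(3)[OF s w] .
next
  fix w w' assume "w \<in> W" "w' \<in> W" "w \<noteq> w'"
  then show "K w \<inter> K w' = {}" using stage_vertex(4)[OF s] by blast
qed

text \<open>The cut point becomes an end outside the region: as an inner point of the old arc it
  lies in no bag and on no other arc.\<close>

lemma stage_shrink:
  assumes s: "stage F W K" and \<alpha>: "(e, a, b) \<in> F" and c: "c \<in> open_segment a b"
  shows "stage (insert (e, c, b) (F - {(e, a, b)})) W K"
    "region (insert (e, c, b) (F - {(e, a, b)})) W K = region (F - {(e, a, b)}) W K \<union> seg e c b"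
proof -
  let ?F = "insert (e, c, b) (F - {(e, a, b)})"
  let ?R = "region ?F W K"
  show R: "?R = region (F - {(e, a, b)}) W K \<union> seg e c b"
    by (rule region_insert)
  have os: "open_segment c b \<subseteq> open_segment a b" "c \<notin> open_segment c b" "c \<noteq> b"
    using c by (auto simp: open_segment_eq_real_ivl split: if_splits)
  then have ss: "seg e c b \<subseteq> seg e a b" by (auto simp: seg_def)
  have "seg e a b \<subseteq> region F W K" using \<alpha> by (auto simp: region_def)
  then have sub: "?R \<subseteq> region F W K" using R ss region_mono[of "F - {(e,a,b)}" F W W K] by blast
  have cr: "0 < c" "c < elen G e"
    using c open_segment_real_subset[OF stage_arc(2,3)[OF s \<alpha>]] by auto
  have fst_ne: "e' \<noteq> e" if "(e', a', b') \<in> F - {(e, a, b)}" for e' a' b'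
    using s \<alpha> that unfolding stage_def inj_on_def by (metis DiffE fst_conv insertI1)
  have "Pt e c \<notin> ?R"
  proof -
    have "Pt e c \<in> seg e a b" using c by (auto simp: seg_def)
    then have "Pt e c \<notin> K w" if "w \<in> W" for w using stage_arc(7)[OF s \<alpha> that] by blast
    moreover have "Pt e c \<notin> seg e c b" using os by (auto simp: seg_def)
    moreover have "Pt e c \<notin> seg e' a' b'" if "(e', a', b') \<in> F - {(e, a, b)}" for e' a' b'
      using fst_ne[OF that] by (auto simp: seg_def)
    ultimately show ?thesis unfolding region_def by auto
  qed
  then have cR: "edge_map G e c \<notin> ?R" using cr by (simp add: edge_map_inner)
  show "stage ?F W K"
  proof (rule stageI)
    have "inj_on fst (F - {(e, a, b)})" using s inj_on_diff unfolding stage_def by blast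
    moreover have "fst (e, c, b) \<notin> fst ` (F - {(e, a, b)} - {(e, c, b)})" using fst_ne by force
    ultimately show "inj_on fst ?F" by (subst inj_on_insert) simp
    show "finite ?F" "finite W" "W \<subseteq> verts G" using s unfolding stage_def by auto
  next
    fix e' a' b' assume "(e', a', b') \<in> ?F"
    then consider "e' = e" "a' = c" "b' = b" | (old) "(e', a', b') \<in> F" by blast
    note cases = this
    then show "e' \<in> edges G \<and> a' \<in> {0..elen G e'} \<and> b' \<in> {0..elen G e'} \<and> a' \<noteq> b'"
    proof cases
      case 1
      then show ?thesis using stage_arc(1,3)[OF s \<alpha>] cr os by auto
    next
      case old
      then show ?thesis using stage_arc(1-4)[OF s] by blast
    qed
    show "(edge_map G e' a' \<in> Vtx ` W \<or> edge_map G e' a' \<notin> ?R) \<and>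
      (edge_map G e' b' \<in> Vtx ` W \<or> edge_map G e' b' \<notin> ?R)"
      using cases
    proof cases
      case 1
      then show ?thesis using cR stage_arc(6)[OF s \<alpha>] sub by blast
    next
      case old
      then show ?thesis using stage_arc(5,6)[OF s old] sub by blast
    qed
    fix w assume w: "w \<in> W"
    show "K w \<inter> seg e' a' b' = {}" using cases
    proof cases
      case 1
      then show ?thesis using stage_arc(7)[OF s \<alpha> w] ss by blast
    next
      case old
      then show ?thesis using stage_arc(7)[OF s old w] by blast
    qed
  next
    fix w assume w: "w \<in> W"
    then have "K w \<subseteq> ?R" by (auto simp: region_def)
    then show "closedin (subtopology T ?R) (K w)"
      using closedin_subtopology_subset[OF stage_vertex(3)[OF s w] _ sub] by blast
    show "Vtx w \<in> K w \<and> conn_piece G (K w)" using stage_vertex(1,2)[OF s w] by blast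
  next
    fix w w' assume "w \<in> W" "w' \<in> W" "w \<noteq> w'"
    then show "K w \<inter> K w' = {}" using stage_vertex(4)[OF s] by blast
  qed
qed

section \<open>Leaf arcs\<close>

text \<open>W0 holds the vertex at the end a of a leaf arc, and is empty when that end is not live.\<close>
definition leaf where
  "leaf F W K W0 e a b \<longleftrightarrow> stage F W K \<and> (e, a, b) \<in> F \<and> W0 \<subseteq> W \<and>
    path_connectedin T (region {} W0 K) \<and>
    (edge_map G e a \<in> region {} W0 K \<or> region {} W0 K = {} \<and> edge_map G e a \<notin> region F W K) \<and>
    edge_map G e b \<notin> Vtx ` W0 \<and>
    (\<forall>e' a' b'. (e', a', b') \<in> F - {(e, a, b)} \<longrightarrow>
       edge_map G e' a' \<notin> Vtx ` W0 \<and> edge_map G e' b' \<notin> Vtx ` W0)"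

lemma leafD:
  assumes "leaf F W K W0 e a b"
  shows "stage F W K" "(e, a, b) \<in> F" "W0 \<subseteq> W" "path_connectedin T (region {} W0 K)"
    "edge_map G e a \<in> region {} W0 K \<or> region {} W0 K = {} \<and> edge_map G e a \<notin> region F W K"
    "edge_map G e b \<notin> Vtx ` W0"
    "\<And>e' a' b'. (e', a', b') \<in> F - {(e, a, b)} \<Longrightarrow>
       edge_map G e' a' \<notin> Vtx ` W0 \<and> edge_map G e' b' \<notin> Vtx ` W0"
  using assms unfolding leaf_def by blast+

lemma segment_facts:
  fixes a b c :: real
  assumes "c \<in> closed_segment a b"
  shows "open_segment a c \<subseteq> open_segment a b" "open_segment c b \<subseteq> open_segment a b"
    "open_segment a b \<subseteq> open_segment a c \<union> closed_segment c b"
    "open_segment a c \<inter> open_segment c b = {}" "c \<notin> open_segment a c"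
    "c \<noteq> a \<Longrightarrow> c \<noteq> b \<Longrightarrow> c \<in> open_segment a b"
  using assms by (auto simp: open_segment_eq_real_ivl closed_segment_eq_real_ivl split: if_splits)

lemma closed_segment_bounds:
  fixes a b c :: real
  assumes "c \<in> closed_segment a b" "a \<in> {0..l}" "b \<in> {0..l}"
  shows "c \<in> {0..l}"
  using assms by (auto simp: closed_segment_eq_real_ivl split: if_splits)

lemma is_piece_bags:
  assumes "leaf F W K W0 e a b"
  shows "is_piece G (region {} W0 K)"
  by (rule region_is_piece, rule stage_restrict[OF leafD(1)[OF assms]]) (use leafD(3)[OF assms] in auto)

text \<open>No other arc is attached to the bag at the leaf end, so the branch up to position
  \<open>c\<close> can be left only through the point at \<open>c\<close>. Each of the two openness
  clauses is obtained from a relatively closed complement.\<close>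

lemma leaf_gate:
  assumes l: "leaf F W K W0 e a b" and c: "c \<in> closed_segment a b" "c \<noteq> a"
  shows "gate (region F W K) (region {} W0 K \<union> seg e a c) (edge_map G e c)"
proof -
  let ?R = "region F W K" and ?C = "region {} W0 K" and ?p = "edge_map G e c"
  let ?X = "?C \<union> seg e a c" and ?rest = "region (F - {(e, a, b)}) (W - W0) K"
  note s = leafD(1)[OF l] and \<alpha> = leafD(2)[OF l]
  note sf = segment_facts[OF c(1)]
  have ea: "e \<in> edges G" "a \<in> {0..elen G e}" "b \<in> {0..elen G e}" using stage_arc[OF s \<alpha>] by auto
  have cb: "c \<in> {0..elen G e}" using closed_segment_bounds[OF c(1) ea(2,3)] .
  have rest: "?rest = ?R - (?C \<union> seg e a b)"
  proof -
    have "region {(e, a, b)} W0 K = ?C \<union> seg e a b" by (rule region_insert)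
    then show ?thesis using region_Diff[OF s, of "{(e, a, b)}" W0] \<alpha> leafD(3)[OF l] by simp
  qed
  have inner: "edge_map G e t = Pt e t" if "t \<in> open_segment a b" for t
    using subsetD[OF open_segment_real_subset[OF ea(2,3)] that] by (simp add: edge_map_inner)
  have segs: "seg e a c \<subseteq> seg e a b" "seg e c b \<subseteq> seg e a b" "seg e a c \<inter> seg e c b = {}"
    using sf by (auto simp: seg_def)
  have CR: "?C \<union> seg e a b \<subseteq> ?R" using \<alpha> leafD(3)[OF l] by (auto simp: region_def)
  have disj: "?C \<inter> seg e a b = {}"
    using stage_arc(7)[OF s \<alpha>] leafD(3)[OF l] by (auto simp: region_def)
  have XR: "?X \<subseteq> ?R" using CR segs by blast
  have bX: "edge_map G e b \<in> ?rest" if bR: "edge_map G e b \<in> ?R"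
  proof -
    obtain w where w: "w \<in> W" "edge_map G e b = Vtx w" using stage_arc(6)[OF s \<alpha>] bR by blast
    then have "w \<in> W - W0" using leafD(6)[OF l] by force
    then show ?thesis using w stage_vertex(1)[OF s] by (auto simp: region_def)
  qed
  have pX: "?p \<notin> ?X"
  proof (cases "c = b")
    case True
    then show ?thesis using bX rest XR segs by blast
  next
    case False
    then have "c \<in> open_segment a b" using sf(6) c by blast
    then have "?p = Pt e c" "Pt e c \<in> seg e a b" using inner by (auto simp: seg_def)
    moreover have "Pt e c \<notin> seg e a c" using sf(5) by (auto simp: seg_def)
    ultimately show ?thesis using disj by auto
  qed
  \<comment> \<open>Closing the remaining part of the arc adds its two ends, and neither of them
    belongs to the branch. So the complement of the branch is relatively closed.\<close>
  have A: "?R - ?X = ?rest \<union> (?R \<inter> cseg G e c b)"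
  proof (rule subset_antisym)
    show "?R - ?X \<subseteq> ?rest \<union> (?R \<inter> cseg G e c b)"
    proof
      fix x assume x: "x \<in> ?R - ?X"
      show "x \<in> ?rest \<union> (?R \<inter> cseg G e c b)"
      proof (cases "x \<in> seg e a b")
        case True
        then obtain t where t: "x = Pt e t" "t \<in> open_segment a b" by (auto simp: seg_def)
        then have "t \<notin> open_segment a c" using x by (auto simp: seg_def)
        then have "t \<in> closed_segment c b" using t sf(3) by blast
        then have "edge_map G e t \<in> cseg G e c b" by (simp add: cseg_def)
        then show ?thesis using t inner x by simp
      next
        case False
        then show ?thesis using x rest by blast
      qed
    qed
    have "x \<notin> ?X" if xR: "x \<in> ?R" "x \<in> cseg G e c b" for x
    proof -
      consider "x \<in> seg e c b" | "x = ?p" | "x = edge_map G e b"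
        using xR(2) cseg_eq[OF cb ea(3)] by blast
      then show ?thesis
      proof cases
        case 1
        then show ?thesis using segs disj by blast
      next
        case 2
        then show ?thesis using pX by simp
      next
        case 3
        then show ?thesis using bX xR rest segs by blast
      qed
    qed
    then show "?rest \<union> (?R \<inter> cseg G e c b) \<subseteq> ?R - ?X" using rest segs by blast
  qed
  \<comment> \<open>The closed segment from \<open>a\<close> to \<open>c\<close> adds only the exit
    to the branch within the region: the point at \<open>a\<close> is already in the bag or lies
    outside the region.\<close>
  have B: "?R - ?X - {?p} = ?R - (?C \<union> (?R \<inter> cseg G e a c))"
    using cseg_eq[OF ea(2) cb] leafD(5)[OF l] by blast
  have ts: "topspace (subtopology T ?R) = ?R" using region_points[OF s] by auto
  have clc: "closedin (subtopology T ?R) (?R \<inter> cseg G e x y)" if "x \<in> {0..elen G e}" "y \<in> {0..elen G e}" for x y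
    using closedin_cseg[OF ea(1) that] by (simp add: closedin_subtopology_Int_closed)
  have "closedin (subtopology T ?R) ?rest"
    using leafD(7)[OF l] \<alpha> leafD(3)[OF l] by (intro closedin_rest[OF s]) auto
  then have "closedin (subtopology T ?R) (?R - ?X)"
    unfolding A using clc cb ea by (intro closedin_Un)
  then have o1: "openin (subtopology T ?R) ?X"
    using XR ts by (metis closedin_def double_diff order_refl)
  have "finite W0" using leafD(3)[OF l] stage_finite(2)[OF s] by (rule finite_subset)
  moreover have "closedin (subtopology T ?R) (K w)" if "w \<in> W0" for w
    using stage_vertex(3)[OF s] leafD(3)[OF l] that by blast
  ultimately have "closedin (subtopology T ?R) (\<Union>w\<in>W0. K w)"
    by (intro closedin_Union) auto
  then have "closedin (subtopology T ?R) ?C" by (simp add: region_def)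
  then have "closedin (subtopology T ?R) (?C \<union> (?R \<inter> cseg G e a c))"
    using clc cb ea by (intro closedin_Un)
  then have "openin (subtopology T ?R) (?R - ?X - {?p})"
    unfolding B using ts by (metis openin_diff openin_topspace)
  with o1 XR pX show ?thesis by (simp add: gate_def)
qed

text \<open>With a live end the arc is glued to the bag at the point of position \<open>a\<close>;
  without one the branch is just an open segment.\<close>

lemma leaf_conn:
  assumes l: "leaf F W K W0 e a b" and c: "c \<in> closed_segment a b"
  shows "conn_piece G (region {} W0 K \<union> seg e a c)"
proof -
  let ?C = "region {} W0 K"
  note s = leafD(1)[OF l] and \<alpha> = leafD(2)[OF l]
  have ea: "e \<in> edges G" "a \<in> {0..elen G e}" "b \<in> {0..elen G e}" using stage_arc[OF s \<alpha>] by auto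
  have cb: "c \<in> {0..elen G e}" using closed_segment_bounds[OF c ea(2,3)] .
  have os: "open_segment a c \<subseteq> {0<..<elen G e}" using open_segment_real_subset[OF ea(2) cb] .
  have im: "edge_map G e ` open_segment a c = seg e a c"
    unfolding seg_def using os by (intro image_cong refl) (auto simp: edge_map_inner)
  have "path_connectedin T (?C \<union> seg e a c)"
  proof (cases "?C = {}")
    case True
    have "path_connectedin T (edge_map G e ` open_segment a c)"
      by (rule path_connectedin_edge_image[OF ea(1)])
        (use os in \<open>auto intro!: convex_imp_path_connected\<close>)
    then show ?thesis using True im by simp
  next
    case False
    have "is_interval (insert a (open_segment a c))"
      by (auto simp: is_interval_1 open_segment_eq_real_ivl split: if_splits)
    then have "path_connected (insert a (open_segment a c))"
      by (simp add: convex_imp_path_connected is_interval_convex)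
    then have "path_connectedin T (edge_map G e ` insert a (open_segment a c))"
      using os ea by (intro path_connectedin_edge_image) auto
    then have "path_connectedin T (?C \<union> edge_map G e ` insert a (open_segment a c))"
      using leafD(4,5)[OF l] False by (intro path_connectedin_Un[of _ _ "edge_map G e a"]) auto
    moreover have "?C \<union> edge_map G e ` insert a (open_segment a c) = ?C \<union> seg e a c"
      using im leafD(5)[OF l] False by auto
    ultimately show ?thesis by simp
  qed
  moreover have "is_piece G (?C \<union> seg e a c)"
    using is_piece_bags[OF l] is_piece_seg[OF ea(1,2) cb] by (rule is_piece_Un)
  ultimately show ?thesis by (simp add: conn_piece_def)
qed

lemma piece_len_seg_Diff:
  assumes e: "e \<in> edges G" and a: "a \<in> {0..elen G e}" and d: "d \<in> {0..elen G e}"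
    and c: "c \<in> closed_segment a d"
  shows "piece_len G (seg e a d - seg e a c) = \<bar>d - c\<bar>"
proof -
  have cb: "c \<in> {0..elen G e}" using closed_segment_bounds[OF c a d] .
  have "seg e a c \<subseteq> seg e a d" using segment_facts(1)[OF c] by (auto simp: seg_def)
  then have "piece_len G (seg e a d - seg e a c) = \<bar>a - d\<bar> - \<bar>a - c\<bar>"
    using piece_len_Diff[OF is_piece_seg[OF e a d] is_piece_seg[OF e a cb]]
      piece_len_seg[OF e a d] piece_len_seg[OF e a cb] by simp
  also have "\<dots> = \<bar>d - c\<bar>" using c by (auto simp: closed_segment_eq_real_ivl split: if_splits)
  finally show ?thesis .
qed

text \<open>Of the two positions one is passed before the other when starting from \<open>a\<close>,
  so the branches are nested and differ by at most the stretch between the positions.\<close>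

lemma piece_len_sym_diff_seg:
  assumes e: "e \<in> edges G" and a: "a \<in> {0..elen G e}" and b: "b \<in> {0..elen G e}"
    and c: "c \<in> closed_segment a b" and d: "d \<in> closed_segment a b" and C: "is_piece G C"
  shows "piece_len G (((C \<union> seg e a c) - (C \<union> seg e a d)) \<union> ((C \<union> seg e a d) - (C \<union> seg e a c))) \<le> \<bar>c - d\<bar>"
proof -
  have *: "piece_len G (((C \<union> seg e a c) - (C \<union> seg e a d)) \<union> ((C \<union> seg e a d) - (C \<union> seg e a c))) \<le> \<bar>c - d\<bar>"
    if c: "c \<in> closed_segment a d" and d: "d \<in> {0..elen G e}" for c d
  proof -
    have cb: "c \<in> {0..elen G e}" using closed_segment_bounds[OF c a d] .
    have "seg e a c \<subseteq> seg e a d" using segment_facts(1)[OF c] by (auto simp: seg_def)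
    then have "((C \<union> seg e a c) - (C \<union> seg e a d)) \<union> ((C \<union> seg e a d) - (C \<union> seg e a c)) \<subseteq> seg e a d - seg e a c"
      by blast
    then have "piece_len G (((C \<union> seg e a c) - (C \<union> seg e a d)) \<union> ((C \<union> seg e a d) - (C \<union> seg e a c)))
        \<le> piece_len G (seg e a d - seg e a c)"
      using C is_piece_seg[OF e a cb] is_piece_seg[OF e a d]
      by (intro piece_len_mono is_piece_Un is_piece_Diff)
    then show ?thesis using piece_len_seg_Diff[OF e a d c] by simp
  qed
  have "c \<in> closed_segment a d \<or> d \<in> closed_segment a c"
    using c d by (auto simp: closed_segment_eq_real_ivl split: if_splits)
  then show ?thesis
    using *[of c d] *[of d c] closed_segment_bounds[OF c a b] closed_segment_bounds[OF d a b]
    by (auto simp: Un_commute abs_minus_commute)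
qed

text \<open>The parameter \<open>t\<close> moves the cut point linearly from \<open>a\<close> to
  \<open>b\<close>, and \<open>H\<close> collects the parameters at which some agent is satisfied.
  By continuity \<open>H\<close> is closed and has a least element, which is positive because the
  bag alone satisfies nobody. A branch slightly shorter serves as \<open>Y\<close>; a branch
  slightly longer serves as \<open>X\<close>, because the other agents also lose the cut
  point.\<close>

lemma leaf_threshold:
  assumes l: "leaf F W K W0 e a b" and J: "finite J" "\<And>j. j \<in> J \<Longrightarrow> valuation G (v j)"
    and small: "\<And>j. j \<in> J \<Longrightarrow> v j (region {} W0 K) < m j"
    and large: "j0 \<in> J" "m j0 \<le> v j0 (region {} W0 K \<union> seg e a b)"
  obtains c i where "c \<in> closed_segment a b" "c \<noteq> a" "i \<in> J" "m i \<le> v i (region {} W0 K \<union> seg e a c)"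
    "\<And>j \<delta>. j \<in> J \<Longrightarrow> \<delta> > 0 \<Longrightarrow> \<exists>X p Y q. gate (region F W K) X p \<and> is_piece G X \<and>
       region {} W0 K \<union> seg e a c \<union> (if c = b then {} else {edge_map G e c}) \<subseteq> X \<and>
       gate (region F W K) Y q \<and> is_piece G Y \<and> v j Y < m j \<and> piece_len G (X - Y) < \<delta>"
proof -
  let ?C = "region {} W0 K"
  note s = leafD(1)[OF l] and \<alpha> = leafD(2)[OF l]
  have ea: "e \<in> edges G" "a \<in> {0..elen G e}" "b \<in> {0..elen G e}" and ab: "a \<noteq> b"
    using stage_arc[OF s \<alpha>] by auto
  have Cp: "is_piece G ?C" using is_piece_bags[OF l] .
  define p where "p t = a + t * (b - a)" for t
  define X where "X t = ?C \<union> seg e a (p t)" for t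
  have pc: "p t \<in> closed_segment a b" if "t \<in> {0..1}" for t
    using that unfolding closed_segment_def p_def
    by (auto intro!: exI[of _ t] simp: algebra_simps)
  have Xp: "is_piece G (X t)" if "t \<in> {0..1}" for t
    using leaf_conn[OF l pc[OF that]] by (simp add: X_def conn_piece_def)
  have dist: "piece_len G ((X x - X t) \<union> (X t - X x)) \<le> \<bar>x - t\<bar> * \<bar>b - a\<bar>"
    if "x \<in> {0..1}" "t \<in> {0..1}" for x t
  proof -
    have "\<bar>p x - p t\<bar> = \<bar>x - t\<bar> * \<bar>b - a\<bar>"
      unfolding p_def by (simp add: abs_mult[symmetric] algebra_simps)
    then show ?thesis
      using piece_len_sym_diff_seg[OF ea pc[OF that(1)] pc[OF that(2)] Cp] by (simp add: X_def)
  qed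
  have cont: "continuous_on {0..1} (\<lambda>t. v j (X t))" if j: "j \<in> J" for j
    unfolding continuous_on_iff
  proof (intro ballI allI impI)
    fix t \<epsilon> :: real assume t: "t \<in> {0..1}" and "0 < \<epsilon>"
    then obtain \<delta> where \<delta>: "\<delta> > 0" "\<And>Y. is_piece G Y \<Longrightarrow>
        piece_len G ((X t - Y) \<union> (Y - X t)) < \<delta> \<Longrightarrow> \<bar>v j (X t) - v j Y\<bar> < \<epsilon>"
      using J(2)[OF j] Xp[OF t] unfolding valuation_def by metis
    have "dist (v j (X x)) (v j (X t)) < \<epsilon>" if x: "x \<in> {0..1}" "dist x t < \<delta> / \<bar>b - a\<bar>" for x
    proof -
      have "\<bar>t - x\<bar> * \<bar>b - a\<bar> < \<delta>"
        using x(2) ab by (simp add: dist_real_def abs_minus_commute pos_less_divide_eq)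
      then have "\<bar>v j (X t) - v j (X x)\<bar> < \<epsilon>" using dist[OF t x(1)] Xp[OF x(1)] by (intro \<delta>(2)) auto
      then show ?thesis by (simp add: dist_real_def abs_minus_commute)
    qed
    moreover have "\<delta> / \<bar>b - a\<bar> > 0" using \<delta>(1) ab by simp
    ultimately show "\<exists>d>0. \<forall>x'\<in>{0..1}. dist x' t < d \<longrightarrow> dist (v j (X x')) (v j (X t)) < \<epsilon>" by blast
  qed
  define H where "H = (\<Union>j\<in>J. {t \<in> {0..1}. m j \<le> v j (X t)})"
  have "closed {t \<in> {0..1}. m j \<le> v j (X t)}" if "j \<in> J" for j
    using continuous_closed_preimage[OF cont[OF that] closed_atLeastAtMost closed_atLeast, of "m j"]
    by (simp add: vimage_def Int_def)
  then have "closed H" unfolding H_def using J(1) by (intro closed_UN) auto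
  moreover have "H \<subseteq> {0..1}" by (auto simp: H_def)
  ultimately have "compact H" by (meson bounded_closed_interval bounded_subset compact_eq_bounded_closed bounded_closed_interval compact_Icc compact_imp_bounded)
  moreover have "1 \<in> H" using large by (auto simp: H_def X_def p_def)
  ultimately obtain t where t: "t \<in> H" "\<And>x. x \<in> H \<Longrightarrow> t \<le> x"
    using compact_attains_inf[of H] by blast
  obtain i where i: "i \<in> J" "m i \<le> v i (X t)" using t by (auto simp: H_def)
  have t01: "t \<in> {0..1}" using t \<open>H \<subseteq> {0..1}\<close> by blast
  have "X 0 = ?C" by (simp add: X_def p_def seg_def)
  then have t0: "t > 0" using small[OF i(1)] i(2) t01 by (cases "t = 0") auto
  have gateX: "gate (region F W K) (X x) (edge_map G e (p x))" if "0 < x" "x \<le> 1" for x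
    unfolding X_def using that ab by (intro leaf_gate[OF l pc]) (auto simp: p_def)
  have thin: "\<exists>X' p' Y q. gate (region F W K) X' p' \<and> is_piece G X' \<and>
       X t \<union> (if p t = b then {} else {edge_map G e (p t)}) \<subseteq> X' \<and>
       gate (region F W K) Y q \<and> is_piece G Y \<and> v j Y < m j \<and> piece_len G (X' - Y) < \<delta>"
    if j: "j \<in> J" and \<delta>: "\<delta> > 0" for j \<delta>
  proof -
    \<comment> \<open>Both parameters below stay within \<open>\<eta>\<close> of \<open>t\<close>,
      so the thin set has length at most
      \<open>2 * \<eta> * \<bar>b - a\<bar> = \<delta> / 2\<close>.\<close>
    define \<eta> where "\<eta> = \<delta> / (4 * \<bar>b - a\<bar>)"
    have \<eta>: "\<eta> > 0" "\<eta> * \<bar>b - a\<bar> = \<delta> / 4" using \<delta> ab by (auto simp: \<eta>_def)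
    \<comment> \<open>The bound \<open>t / 2\<close> keeps \<open>x\<close> positive, since a gate
      exists only at positions different from \<open>a\<close>; the bound 1 on \<open>y\<close>
      keeps the longer branch on the arc.\<close>
    define x where "x = max (t / 2) (t - \<eta>)"
    define y where "y = min 1 (t + \<eta>)"
    have x: "0 < x" "x < t" "t - x \<le> \<eta>" using t0 \<eta> by (auto simp: x_def)
    have y: "t \<le> y" "y \<le> 1" "y - t \<le> \<eta>" "t = 1 \<or> t < y" using t01 \<eta> by (auto simp: y_def)
    have x01: "x \<in> {0..1}" and y01: "y \<in> {0..1}" using x y t01 by auto
    have "x \<notin> H" using t(2) x by fastforce
    then have "v j (X x) < m j" using j x01 by (auto simp: H_def)
    moreover have "gate (region F W K) (X x) (edge_map G e (p x))" using gateX x x01 by simp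
    moreover have "gate (region F W K) (X y) (edge_map G e (p y))" using gateX y t0 by simp
    moreover have "X t \<union> (if p t = b then {} else {edge_map G e (p t)}) \<subseteq> X y"
    proof -
      have pty: "p t \<in> closed_segment a (p y)"
        unfolding closed_segment_def
      proof (intro CollectI exI conjI)
        show "p t = (1 - t / y) *\<^sub>R a + (t / y) *\<^sub>R p y"
          using y t0 by (simp add: p_def field_simps)
      qed (use y t0 in auto)
      have "X t \<subseteq> X y" unfolding X_def seg_def using segment_facts(1)[OF pty] by blast
      moreover have "edge_map G e (p t) \<in> X y" if "p t \<noteq> b"
      proof -
        have "t \<noteq> 1" using that by (auto simp: p_def)
        then have "p t \<noteq> a" "p t \<noteq> p y" using t0 y ab by (auto simp: p_def)
        then have "p t \<in> open_segment a (p y)" using pty by (simp add: open_segment_def)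
        moreover have "p t \<in> open_segment a b"
          using pc[OF t01] \<open>p t \<noteq> a\<close> that by (simp add: open_segment_def)
        then have "edge_map G e (p t) = Pt e (p t)"
          using open_segment_real_subset[OF ea(2,3)] by (auto intro!: edge_map_inner)
        ultimately show ?thesis by (simp add: X_def seg_def)
      qed
      ultimately show ?thesis by simp
    qed
    moreover have "piece_len G (X y - X x) < \<delta>"
    proof -
      have "piece_len G (X y - X x) \<le> piece_len G ((X y - X x) \<union> (X x - X y))"
        using Xp[OF x01] Xp[OF y01] by (intro piece_len_mono is_piece_Un is_piece_Diff) auto
      also have "\<dots> \<le> \<bar>y - x\<bar> * \<bar>b - a\<bar>" using dist[OF y01 x01] .
      also have "\<dots> \<le> (2 * \<eta>) * \<bar>b - a\<bar>"
        using x y by (intro mult_right_mono) auto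
      also have "\<dots> = \<delta> / 2" using \<eta>(2) by simp
      also have "\<dots> < \<delta>" using \<delta> by simp
      finally show ?thesis .
    qed
    ultimately show ?thesis using Xp[OF x01] Xp[OF y01] by blast
  qed
  show thesis
  proof (rule that[of "p t" i])
    show "p t \<in> closed_segment a b" using pc[OF t01] .
    show "p t \<noteq> a" using t0 ab by (simp add: p_def)
    show "i \<in> J" using i by simp
    show "m i \<le> v i (?C \<union> seg e a (p t))" using i by (simp add: X_def)
    show "\<exists>X' p' Y q. gate (region F W K) X' p' \<and> is_piece G X' \<and>
       ?C \<union> seg e a (p t) \<union> (if p t = b then {} else {edge_map G e (p t)}) \<subseteq> X' \<and>
       gate (region F W K) Y q \<and> is_piece G Y \<and> v j Y < m j \<and> piece_len G (X' - Y) < \<delta>"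
      if "j \<in> J" "\<delta> > 0" for j \<delta>
      using thin[OF that] unfolding X_def .
  qed
qed

end

section \<open>Leaf edges of acyclic multigraphs\<close>

definition joins :: "('v, 'e) cgraph \<Rightarrow> 'e \<Rightarrow> 'v set" where
  "joins G e = {fst (ends G e), snd (ends G e)}"

lemma joins_eqD: "joins G e = {x, y} \<Longrightarrow> ends G e = (x, y) \<or> ends G e = (y, x)"
  by (cases "ends G e") (auto simp: joins_def doubleton_eq_iff)

definition is_path where
  "is_path G E0 vs es \<longleftrightarrow> length vs = Suc (length es) \<and> distinct vs \<and> distinct es \<and> es \<noteq> [] \<and>
     set es \<subseteq> E0 \<and> (\<forall>i<length es. joins G (es ! i) = {vs ! i, vs ! Suc i})"

text \<open>The first vertex of a longest path is incident to no further edge: such an edge would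
  either extend the path or close a cycle.\<close>
lemma exists_leaf_edge:
  assumes fin: "finite (verts G)" and E0: "E0 \<subseteq> edges G" "E0 \<noteq> {}"
    and ends: "\<And>e. e \<in> E0 \<Longrightarrow> joins G e \<subseteq> verts G - S"
    and acyclic: "\<not> has_cycle_minus G S"
  shows "\<exists>e\<in>E0. \<exists>w x. joins G e = {w, x} \<and> w \<noteq> x \<and> (\<forall>e'\<in>E0. w \<in> joins G e' \<longrightarrow> e' = e)"
proof -
  have loopfree: "x \<noteq> y" if e: "e \<in> E0" "joins G e = {x, y}" for e x y
  proof
    assume "x = y"
    then have "ends G e = (x, x)" "x \<in> verts G - S"
      using joins_eqD[OF e(2)] ends[OF e(1)] e(2) by auto
    then have "has_cycle_minus G S" unfolding has_cycle_minus_def using E0 e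
      by (intro exI[of _ "[x]"] exI[of _ "[e]"]) auto
    then show False using acyclic by simp
  qed
  have vsub: "set vs \<subseteq> verts G - S" if p: "is_path G E0 vs es" for vs es
  proof
    fix x assume "x \<in> set vs"
    then obtain i where i: "i < length vs" "vs ! i = x" by (auto simp: in_set_conv_nth)
    have len: "length vs = Suc (length es)" "es \<noteq> []" "set es \<subseteq> E0" using p by (auto simp: is_path_def)
    \<comment> \<open>Every vertex of the path starts an edge of it except the last one, for which
      the preceding edge is taken.\<close>
    define k where "k = (if i < length es then i else i - 1)"
    have "length es > 0" using len by simp
    then have "i - 1 < length es" "i < length es \<or> i = Suc (i - 1)" using i(1) len(1) by linarith+
    then have k: "k < length es" "i = k \<or> i = Suc k" unfolding k_def by simp_all
    then have "x \<in> joins G (es ! k)" using p i unfolding is_path_def by auto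
    then show "x \<in> verts G - S" using ends[of "es ! k"] k len nth_mem[OF k(1)] by blast
  qed
  obtain e0 where e0: "e0 \<in> E0" using E0 by blast
  obtain x0 y0 where xy0: "joins G e0 = {x0, y0}" by (auto simp: joins_def)
  have P0: "is_path G E0 [x0, y0] [e0]" using e0 xy0 loopfree[OF e0 xy0] by (auto simp: is_path_def)
  have bound: "length (fst q) \<le> card (verts G)" if "is_path G E0 (fst q) (snd q)" for q
  proof -
    have "length (fst q) = card (set (fst q))"
      using that by (simp add: is_path_def distinct_card)
    also have "\<dots> \<le> card (verts G)" using vsub[OF that] by (intro card_mono[OF fin]) auto
    finally show ?thesis .
  qed
  have "\<exists>q. is_path G E0 (fst q) (snd q) \<and> (\<forall>q'. is_path G E0 (fst q') (snd q') \<longrightarrow> length (fst q') \<le> length (fst q))"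
    by (rule ex_has_greatest_nat[where k = "([x0, y0], [e0])" and b = "Suc (card (verts G))"])
      (use P0 bound in \<open>auto simp: less_Suc_eq_le\<close>)
  then obtain vs es where p: "is_path G E0 vs es"
    and max: "\<And>vs' es'. is_path G E0 vs' es' \<Longrightarrow> length vs' \<le> length vs" by auto
  have len: "length vs = Suc (length es)" and dvs: "distinct vs" and des: "distinct es"
    and ne: "es \<noteq> []" "set es \<subseteq> E0"
    and jo: "\<And>i. i < length es \<Longrightarrow> joins G (es ! i) = {vs ! i, vs ! Suc i}"
    using p by (auto simp: is_path_def)
  define w where "w = vs ! 0"
  define e where "e = es ! 0"
  have e: "e \<in> E0" "joins G e = {w, vs ! 1}" using ne jo[of 0] by (auto simp: e_def w_def)
  have "e' = e" if e': "e' \<in> E0" "w \<in> joins G e'" for e'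
  proof (rule ccontr)
    assume "e' \<noteq> e"
    obtain x where x: "joins G e' = {w, x}" using e'(2) by (auto simp: joins_def)
    have "w \<noteq> x" using loopfree[OF e'(1) x] .
    have e'es: "e' \<notin> set es"
    proof
      assume "e' \<in> set es"
      then obtain i where i: "i < length es" "es ! i = e'" by (auto simp: in_set_conv_nth)
      then have "w = vs ! i \<or> w = vs ! Suc i" using jo[OF i(1)] e'(2) by auto
      then have "i = 0" using dvs len i(1) unfolding w_def by (auto simp: nth_eq_iff_index_eq)
      then show False using i \<open>e' \<noteq> e\<close> e_def by simp
    qed
    show False
    proof (cases "x \<in> set vs")
      case False
      have "is_path G E0 (x # vs) (e' # es)"
        unfolding is_path_def
      proof (intro conjI allI impI)
        fix i assume "i < length (e' # es)"
        then show "joins G ((e' # es) ! i) = {(x # vs) ! i, (x # vs) ! Suc i}"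
          using x jo by (cases i) (auto simp: w_def)
      qed (use len dvs des ne e' e'es False in auto)
      from max[OF this] show False by simp
    next
      case True
      then obtain k where k: "k < length vs" "vs ! k = x" by (auto simp: in_set_conv_nth)
      have kl: "k \<le> length es" using k len by simp
      \<comment> \<open>The edge \<open>e'\<close> closes the part of the path from \<open>w\<close>
        to \<open>x\<close> to a cycle; for \<open>k = 1\<close> this is a pair of parallel
        edges.\<close>
      let ?vs = "take (Suc k) vs" and ?es = "take k es @ [e']"
      have "has_cycle_minus G S"
        unfolding has_cycle_minus_def
      proof (intro exI[of _ ?vs] exI[of _ ?es] conjI allI impI)
        show "?es \<noteq> []" by simp
        show "length ?vs = length ?es" using kl len by simp
        show "distinct ?vs" using dvs by simp
        show "distinct ?es" using des e'es by (auto dest: in_set_takeD)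
        show "set ?vs \<subseteq> verts G - S" using vsub[OF p] set_take_subset[of "Suc k" vs] by blast
        show "set ?es \<subseteq> edges G" using E0 ne e' set_take_subset[of k es] by auto
        fix i assume i: "i < length ?es"
        show "ends G (?es ! i) = (?vs ! i, ?vs ! ((i + 1) mod length ?es)) \<or>
            ends G (?es ! i) = (?vs ! ((i + 1) mod length ?es), ?vs ! i)"
        proof (cases "i < k")
          case True
          then have "(i + 1) mod length ?es = Suc i" using kl by simp
          moreover have "?es ! i = es ! i" using True kl by (simp add: nth_append)
          moreover have "joins G (es ! i) = {vs ! i, vs ! Suc i}" using True kl jo by simp
          ultimately show ?thesis using True joins_eqD by simp
        next
          case False
          then have "i = k" using i kl by simp
          moreover have "joins G e' = {vs ! k, vs ! 0}" using x k w_def by auto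
          ultimately show ?thesis using kl joins_eqD by (simp add: nth_append)
        qed
      qed
      then show False using acyclic by simp
    qed
  qed
  then show ?thesis using e loopfree[OF e] by blast
qed

section \<open>The initial stage, the existence of a leaf arc and its absorption\<close>

context cake
begin

lemma closedin_Vtx:
  assumes "w \<in> verts G"
  shows "closedin T {Vtx w}"
proof (rule closedin_cake)
  show "{Vtx w} \<subseteq> points G" using assms by (simp add: points_def)
  fix e
  have "{t \<in> {0..elen G e}. edge_map G e t \<in> {Vtx w}} \<subseteq> {0, elen G e}"
    by (auto simp: edge_map_def split: if_splits)
  then show "closed {t \<in> {0..elen G e}. edge_map G e t \<in> {Vtx w}}"
    by (meson finite.emptyI finite.insertI finite_imp_closed finite_subset)
qed

lemma initial_region:
  "region ((\<lambda>e. (e, 0, elen G e)) ` edges G) (verts G - S) (\<lambda>w. {Vtx w}) = points G - Vtx ` S"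
proof -
  have "seg e 0 (elen G e) = Pt e ` {0<..<elen G e}" if "e \<in> edges G" for e
    using elen_pos[OF that] by (simp add: seg_def open_segment_eq_real_ivl)
  then have "(\<Union>(e, a, b)\<in>(\<lambda>e. (e, 0, elen G e)) ` edges G. seg e a b) =
      (\<Union>e\<in>edges G. Pt e ` {0<..<elen G e})" by auto
  note arcs = this
  show ?thesis unfolding region_def arcs points_def by auto
qed

text \<open>An edge at a deleted vertex keeps its whole open segment; its end in \<open>S\<close>
  merely counts as an end outside the region.\<close>

lemma initial_stage:
  "stage ((\<lambda>e. (e, 0, elen G e)) ` edges G) (verts G - S) (\<lambda>w. {Vtx w})"
proof (rule stageI, unfold initial_region)
  show "finite ((\<lambda>e. (e, 0::real, elen G e)) ` edges G)" "finite (verts G - S)"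
    using finite_edges finite_verts by auto
  show "inj_on fst ((\<lambda>e. (e, 0::real, elen G e)) ` edges G)" by (auto simp: inj_on_def)
next
  fix e and a b :: real assume "(e, a, b) \<in> (\<lambda>e. (e, 0, elen G e)) ` edges G"
  then have e: "e \<in> edges G" "a = 0" "b = elen G e" by auto
  then show "e \<in> edges G \<and> a \<in> {0..elen G e} \<and> b \<in> {0..elen G e} \<and> a \<noteq> b"
    using elen_pos[OF e(1)] by auto
  show "(edge_map G e a \<in> Vtx ` (verts G - S) \<or> edge_map G e a \<notin> points G - Vtx ` S) \<and>
      (edge_map G e b \<in> Vtx ` (verts G - S) \<or> edge_map G e b \<notin> points G - Vtx ` S)"
    using e wf elen_pos[OF e(1)] by (auto simp: edge_map_def wf_cgraph_def)
  show "{Vtx w} \<inter> seg e a b = {}" for w by (auto simp: seg_def)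
next
  fix w assume w: "w \<in> verts G - S"
  show "Vtx w \<in> {Vtx w} \<and> conn_piece G {Vtx w}"
    using w by (auto simp: conn_piece_def is_piece_Vtx points_def)
  have "Vtx w \<in> points G - Vtx ` S" using w by (auto simp: points_def)
  then show "closedin (subtopology T (points G - Vtx ` S)) {Vtx w}"
    using closedin_Vtx[of w] w unfolding closedin_subtopology by blast
qed auto

text \<open>Only the positions 0 and \<open>elen G e\<close> are mapped to vertices, and the two
  ends of an arc are different positions. So an arc with two live ends is a complete edge.\<close>

lemma arc_ends:
  assumes "(e, a, b) \<in> F" "stage F W K" "edge_map G e a \<in> Vtx ` W" "edge_map G e b \<in> Vtx ` W"
  shows "{edge_map G e a, edge_map G e b} = Vtx ` joins G e"
proof -
  have r: "a \<in> {0..elen G e}" "b \<in> {0..elen G e}" "a \<noteq> b" using stage_arc[OF assms(2,1)] by auto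
  have "a \<in> {0, elen G e}" "b \<in> {0, elen G e}"
    using r assms(3,4) by (auto simp: edge_map_def split: if_splits)
  then have "(a = 0 \<and> b = elen G e) \<or> (b = 0 \<and> a = elen G e)" "elen G e > 0" using r by auto
  then show ?thesis by (auto simp: edge_map_def joins_def)
qed

lemma leaf_free:
  assumes s: "stage F W K" and \<alpha>: "(e, a, b) \<in> F" and "edge_map G e a \<notin> region F W K"
  shows "leaf F W K {} e a b"
proof -
  have "region {} {} K = {}" by (simp add: region_def)
  then show ?thesis using assms by (simp add: leaf_def)
qed

lemma leaf_vertex:
  assumes s: "stage F W K" and \<alpha>: "(e, a, b) \<in> F" and w: "w \<in> W"
    and "edge_map G e a = Vtx w" "edge_map G e b \<noteq> Vtx w"
    and "\<And>e' a' b'. (e', a', b') \<in> F - {(e, a, b)} \<Longrightarrow>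
       edge_map G e' a' \<noteq> Vtx w \<and> edge_map G e' b' \<noteq> Vtx w"
  shows "leaf F W K {w} e a b"
proof -
  have "region {} {w} K = K w" by (simp add: region_def)
  then show ?thesis
    using assms stage_vertex(1,2)[OF s w] by (simp add: leaf_def conn_piece_def)
qed

text \<open>An arc with an end outside the region is a leaf arc at that end, with empty
  \<open>W0\<close>. If there is none, all arcs are complete edges between live vertices, so they
  form an acyclic graph and the longest path argument applies.\<close>

lemma exists_leaf:
  assumes s: "stage F W K" and F: "F \<noteq> {}" and acyclic: "\<not> has_cycle_minus G S" and WS: "W \<inter> S = {}"
  shows "\<exists>F' W0 e a b. leaf F' W K W0 e a b \<and> card F' = card F \<and> region F' W K = region F W K \<and>
    (W0 = {} \<or> (\<exists>w. W0 = {w}))"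
proof -
  let ?swap = "\<lambda>e a b. insert (e, b, a) (F - {(e, a, b)})"
  have swap: "stage (?swap e a b) W K" "card (?swap e a b) = card F" "region (?swap e a b) W K = region F W K"
    if \<alpha>: "(e, a, b) \<in> F" for e a b
  proof -
    show "stage (?swap e a b) W K" using stage_swap[OF s \<alpha>] .
    show "region (?swap e a b) W K = region F W K" using region_swap[OF \<alpha>] .
    have "(e, b, a) \<notin> F - {(e, a, b)}"
      using s \<alpha> unfolding stage_def inj_on_def by (metis DiffE fst_conv insertI1)
    then show "card (?swap e a b) = card F"
      using card_Suc_Diff1[OF stage_finite(1)[OF s] \<alpha>] stage_finite(1)[OF s] by simp
  qed
  show ?thesis
  proof (cases "\<exists>e a b. (e, a, b) \<in> F \<and> (edge_map G e a \<notin> Vtx ` W \<or> edge_map G e b \<notin> Vtx ` W)")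
    case True
    then obtain e a b where \<alpha>: "(e, a, b) \<in> F"
      and "edge_map G e a \<notin> Vtx ` W \<or> edge_map G e b \<notin> Vtx ` W" by blast
    then consider "edge_map G e a \<notin> region F W K" | "edge_map G e b \<notin> region F W K"
      using stage_arc(5,6)[OF s \<alpha>] by blast
    then show ?thesis
    proof cases
      case 1
      then show ?thesis using leaf_free[OF s \<alpha>] by blast
    next
      case 2
      have "leaf (?swap e a b) W K {} e b a"
        by (rule leaf_free[OF swap(1)[OF \<alpha>]]) (use 2 swap(3)[OF \<alpha>] in auto)
      then show ?thesis using swap(2,3)[OF \<alpha>] by blast
    qed
  next
    case False
    then have at: "edge_map G e a \<in> Vtx ` W" "edge_map G e b \<in> Vtx ` W" if "(e, a, b) \<in> F" for e a b
      using that by blast+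
    have join: "{edge_map G e a, edge_map G e b} = Vtx ` joins G e" if "(e, a, b) \<in> F" for e a b
      using arc_ends[OF that s at[OF that]] .
    let ?E0 = "fst ` F"
    have "?E0 \<subseteq> edges G" using stage_arc(1)[OF s] by force
    moreover have "joins G e \<subseteq> verts G - S" if "e \<in> ?E0" for e
    proof
      fix x assume x: "x \<in> joins G e"
      obtain a b where \<alpha>: "(e, a, b) \<in> F" using \<open>e \<in> ?E0\<close> by force
      have "Vtx x \<in> {edge_map G e a, edge_map G e b}" using join[OF \<alpha>] x by blast
      then have "x \<in> W" using at[OF \<alpha>] by auto
      then show "x \<in> verts G - S" using WS stage_vertex(5)[OF s] by blast
    qed
    ultimately obtain e w x where e: "e \<in> ?E0" "joins G e = {w, x}" "w \<noteq> x"
      and only: "\<And>e'. e' \<in> ?E0 \<Longrightarrow> w \<in> joins G e' \<Longrightarrow> e' = e"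
      using exists_leaf_edge[OF finite_verts, of ?E0 S] F acyclic by blast
    obtain a b where \<alpha>: "(e, a, b) \<in> F" using e(1) by force
    have others: "edge_map G e' a' \<noteq> Vtx w \<and> edge_map G e' b' \<noteq> Vtx w"
      if \<beta>: "(e', a', b') \<in> F - {(e, a, b)}" for e' a' b'
    proof (rule ccontr)
      assume "\<not> ?thesis"
      then have "Vtx w \<in> {edge_map G e' a', edge_map G e' b'}" by auto
      also have "\<dots> = Vtx ` joins G e'" using \<beta> by (intro join) simp
      finally have "w \<in> joins G e'" by auto
      moreover have "e' \<in> fst ` F" using \<beta> by (intro image_eqI[of _ _ "(e', a', b')"]) auto
      ultimately have "e' = e" using only by blast
      then show False using \<beta> \<alpha> s unfolding stage_def inj_on_def by (metis DiffE fst_conv insertI1)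
    qed
    have jw: "{edge_map G e a, edge_map G e b} = {Vtx w, Vtx x}" using join[OF \<alpha>] e(2) by simp
    then have w: "w \<in> W" using at[OF \<alpha>] by (metis image_iff insert_iff pt.inject(1) singletonD)
    have "edge_map G e a = Vtx w \<and> edge_map G e b \<noteq> Vtx w \<or> edge_map G e b = Vtx w \<and> edge_map G e a \<noteq> Vtx w"
      using jw e(3) by (auto simp: doubleton_eq_iff)
    then show ?thesis
    proof
      assume "edge_map G e a = Vtx w \<and> edge_map G e b \<noteq> Vtx w"
      then have "leaf F W K {w} e a b" using leaf_vertex[OF s \<alpha> w] others by blast
      then show ?thesis by blast
    next
      assume "edge_map G e b = Vtx w \<and> edge_map G e a \<noteq> Vtx w"
      then have "leaf (?swap e a b) W K {w} e b a"
        using leaf_vertex[OF swap(1)[OF \<alpha>] insertI1 w] others by blast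
      then show ?thesis using swap(2,3)[OF \<alpha>] by blast
    qed
  qed
qed

text \<open>Absorption redistributes the region without changing it, so the partitions of the agents
  are not affected. The only exit of the branch is \<open>Vtx u\<close>, which lies in the bag; this
  keeps the enlarged bag relatively closed.\<close>

lemma leaf_merge:
  fixes K :: "'v \<Rightarrow> ('v, 'e) pt set"
  assumes l: "leaf F W K W0 e a b" and u: "u \<in> W" "edge_map G e b = Vtx u"
  defines "K' \<equiv> K(u := K u \<union> (region {} W0 K \<union> seg e a b))"
  shows "u \<in> W - W0" "stage (F - {(e, a, b)}) (W - W0) K'"
    "region (F - {(e, a, b)}) (W - W0) K' = region F W K"
proof -
  let ?C = "region {} W0 K" and ?F = "F - {(e, a, b)}" and ?W = "W - W0" and ?R = "region F W K"
  let ?B = "?C \<union> seg e a b"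
  note s = leafD(1)[OF l] and \<alpha> = leafD(2)[OF l]
  have ea: "e \<in> edges G" "a \<in> {0..elen G e}" "b \<in> {0..elen G e}" "a \<noteq> b"
    using stage_arc[OF s \<alpha>] by auto
  show uW: "u \<in> ?W" using u leafD(6)[OF l] by auto
  have g: "gate ?R ?B (Vtx u)" using leaf_gate[OF l _ ea(4)[symmetric]] u(2) by simp
  have B: "region {(e, a, b)} W0 K = ?B" by (rule region_insert)
  have rest: "region ?F ?W K = ?R - ?B"
    using region_Diff[OF s, of "{(e, a, b)}" W0] \<alpha> leafD(3)[OF l] B by simp
  have BR: "?B \<subseteq> ?R" using g by (simp add: gate_def)
  have K'other: "K' w = K w" if "w \<noteq> u" for w using that by (simp add: K'_def)
  have K'u: "K' u = K u \<union> ?B" by (simp add: K'_def)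
  have "region ?F ?W K' = region ?F ?W K \<union> ?B"
  proof -
    have "(\<Union>w\<in>?W. K' w) = (\<Union>w\<in>?W. K w) \<union> ?B" using uW by (auto simp: K'_def)
    then show ?thesis by (simp add: region_def Un_ac)
  qed
  then show R: "region ?F ?W K' = ?R" using rest BR by blast
  have Kdisj: "K w \<inter> ?B = {}" if "w \<in> ?W" for w
    using rest that by (auto simp: region_def)
  have ts: "topspace (subtopology T ?R) = ?R" using region_points[OF s] by auto
  have uK: "Vtx u \<in> K u" and uR: "K u \<subseteq> ?R" using stage_vertex(1)[OF s u(1)] u(1) by (auto simp: region_def)
  have closed: "closedin (subtopology T ?R) (K u \<union> ?B)"
  proof -
    have "openin (subtopology T ?R) (?R - ?B - {Vtx u})" using g by (simp add: gate_def)
    then have "closedin (subtopology T ?R) (?R - (?R - ?B - {Vtx u}))"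
      using ts by (metis closedin_diff closedin_topspace)
    moreover have "?R - (?R - ?B - {Vtx u}) = ?B \<union> {Vtx u}" using BR uK uR by blast
    ultimately have "closedin (subtopology T ?R) (K u \<union> (?B \<union> {Vtx u}))"
      using stage_vertex(3)[OF s u(1)] closedin_Un by metis
    then show ?thesis using uK by (simp add: insert_absorb)
  qed
  have conn: "conn_piece G (K u \<union> ?B)"
  proof -
    let ?H = "edge_map G e ` insert b (open_segment a b)"
    have cB: "conn_piece G ?B" using leaf_conn[OF l] by simp
    have "is_interval (insert b (open_segment a b))"
      by (auto simp: is_interval_1 open_segment_eq_real_ivl split: if_splits)
    then have pH: "path_connectedin T ?H"
      using ea open_segment_real_subset[OF ea(2,3)]
      by (intro path_connectedin_edge_image) (auto simp: convex_imp_path_connected is_interval_convex)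
    have "edge_map G e ` open_segment a b = seg e a b"
      unfolding seg_def using open_segment_real_subset[OF ea(2,3)]
      by (intro image_cong refl) (auto simp: edge_map_inner)
    then have H: "?H = insert (Vtx u) (seg e a b)" using u(2) by simp
    \<comment> \<open>The branch does not contain the vertex at \<open>b\<close>. It is first glued,
      at an inner point of the arc, to the segment that includes \<open>b\<close>, and that segment
      then meets the bag of \<open>u\<close>.\<close>
    have "midpoint a b \<in> open_segment a b" using ea(4) by simp
    then have mid: "Pt e (midpoint a b) \<in> seg e a b" by (auto simp: seg_def)
    have BH: "path_connectedin T (?B \<union> ?H)"
      by (rule path_connectedin_Un[of _ _ "Pt e (midpoint a b)"])
        (use cB pH mid H in \<open>auto simp: conn_piece_def\<close>)
    have "path_connectedin T (K u \<union> (?B \<union> ?H))"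
      by (rule path_connectedin_Un[OF _ BH, of "K u" "Vtx u"])
        (use stage_vertex(2)[OF s u(1)] uK H in \<open>auto simp: conn_piece_def\<close>)
    moreover have "K u \<union> (?B \<union> ?H) = K u \<union> ?B" unfolding H using uK by blast
    ultimately show ?thesis
      using cB stage_vertex(2)[OF s u(1)] by (simp add: conn_piece_def is_piece_Un)
  qed
  show "stage ?F ?W K'"
  proof (rule stageI, unfold R)
    show "finite ?F" "finite ?W" using stage_finite[OF s] by auto
    show "?W \<subseteq> verts G" "inj_on fst ?F" using s inj_on_diff unfolding stage_def by blast+
  next
    fix e' a' b' assume \<beta>: "(e', a', b') \<in> ?F"
    then have \<beta>F: "(e', a', b') \<in> F" by blast
    show "e' \<in> edges G \<and> a' \<in> {0..elen G e'} \<and> b' \<in> {0..elen G e'} \<and> a' \<noteq> b'"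
      using stage_arc(1-4)[OF s \<beta>F] by blast
    show "(edge_map G e' a' \<in> Vtx ` ?W \<or> edge_map G e' a' \<notin> ?R) \<and>
      (edge_map G e' b' \<in> Vtx ` ?W \<or> edge_map G e' b' \<notin> ?R)"
      using stage_arc(5,6)[OF s \<beta>F] leafD(7)[OF l \<beta>] by blast
    fix w assume w: "w \<in> ?W"
    have "seg e' a' b' \<subseteq> region ?F ?W K" using \<beta> by (auto simp: region_def)
    then have "seg e' a' b' \<inter> ?B = {}" using rest by blast
    then show "K' w \<inter> seg e' a' b' = {}"
      using stage_arc(7)[OF s \<beta>F, of w] w K'u K'other[of w] by (cases "w = u") auto
  next
    fix w assume w: "w \<in> ?W"
    show "Vtx w \<in> K' w \<and> conn_piece G (K' w)"
      using stage_vertex(1,2)[OF s, of w] w conn uK K'u K'other[of w] by (cases "w = u") auto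
    show "closedin (subtopology T ?R) (K' w)"
      using stage_vertex(3)[OF s, of w] w closed K'u K'other[of w] by (cases "w = u") auto
  next
    fix w w' assume w: "w \<in> ?W" "w' \<in> ?W" "w \<noteq> w'"
    then have "K w \<inter> K w' = {}" using stage_vertex(4)[OF s] by blast
    then show "K' w \<inter> K' w' = {}"
      using Kdisj[OF w(1)] Kdisj[OF w(2)] w(3) unfolding K'_def by auto
  qed
qed

section \<open>Allocation on forests\<close>

text \<open>The bound \<open>c\<close> is uniform in \<open>P\<close> because
  \<open>splittable_remove\<close> needs a gap below \<open>m\<close>. For a bag consisting of its
  vertex alone the clause about \<open>P\<close> is vacuous.\<close>

definition agent_ok :: "(('v, 'e) pt set \<Rightarrow> real) \<Rightarrow> real \<Rightarrow> ('v, 'e) pt set \<Rightarrow> 'v set \<Rightarrow>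
    ('v \<Rightarrow> ('v, 'e) pt set) \<Rightarrow> bool" where
  "agent_ok u m R W K \<longleftrightarrow> (\<forall>w\<in>W. u (K w) < m \<and>
     (\<exists>c<m. \<forall>P. conn_piece G P \<longrightarrow> P \<subseteq> R \<longrightarrow> P \<inter> K w \<noteq> {} \<longrightarrow> Vtx w \<notin> P \<longrightarrow> u P \<le> c))"

lemma agent_ok_restrict:
  assumes "agent_ok u m R W K" "R' \<subseteq> R" "W' \<subseteq> W"
  shows "agent_ok u m R' W' K"
  unfolding agent_ok_def
proof (intro ballI conjI)
  fix w assume "w \<in> W'"
  then have w: "w \<in> W" using assms(3) by blast
  show "u (K w) < m" using assms(1) w by (simp add: agent_ok_def)
  obtain c where "c < m" "\<forall>P. conn_piece G P \<longrightarrow> P \<subseteq> R \<longrightarrow> P \<inter> K w \<noteq> {} \<longrightarrow> Vtx w \<notin> P \<longrightarrow> u P \<le> c"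
    using assms(1) w unfolding agent_ok_def by blast
  then show "\<exists>c<m. \<forall>P. conn_piece G P \<longrightarrow> P \<subseteq> R' \<longrightarrow> P \<inter> K w \<noteq> {} \<longrightarrow> Vtx w \<notin> P \<longrightarrow> u P \<le> c"
    using assms(2) by (meson subset_trans)
qed

definition allocatable :: "('i \<Rightarrow> ('v, 'e) pt set \<Rightarrow> real) \<Rightarrow> ('i \<Rightarrow> real) \<Rightarrow> 'i set \<Rightarrow>
    ('v, 'e) pt set \<Rightarrow> bool" where
  "allocatable v m J R \<longleftrightarrow> (\<exists>A. (\<forall>j\<in>J. conn_piece G (A j) \<and> A j \<subseteq> R \<and> m j \<le> v j (A j)) \<and>
     (\<forall>i\<in>J. \<forall>j\<in>J. i \<noteq> j \<longrightarrow> A i \<inter> A j = {}))"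

lemma allocatable_insert:
  assumes "conn_piece G X" "X \<subseteq> R" "m i \<le> v i X" "R' \<subseteq> R" "R' \<inter> X = {}"
    and "allocatable v m (J - {i}) R'"
  shows "allocatable v m J R"
proof -
  obtain A where A: "\<forall>j\<in>J - {i}. conn_piece G (A j) \<and> A j \<subseteq> R' \<and> m j \<le> v j (A j)"
    "\<forall>j\<in>J - {i}. \<forall>k\<in>J - {i}. j \<noteq> k \<longrightarrow> A j \<inter> A k = {}"
    using assms(6) unfolding allocatable_def by (elim exE conjE)
  let ?A = "A(i := X)"
  have "conn_piece G (?A j) \<and> ?A j \<subseteq> R \<and> m j \<le> v j (?A j)" if "j \<in> J" for j
    using bspec[OF A(1), of j] assms(1-4) that by (cases "j = i") auto
  moreover have "?A j \<inter> ?A k = {}" if jk: "j \<in> J" "k \<in> J" "j \<noteq> k" for j k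
  proof -
    consider "j = i" "k \<noteq> i" | "k = i" "j \<noteq> i" | "j \<noteq> i" "k \<noteq> i" using jk by blast
    then show ?thesis
    proof cases
      case 1
      then show ?thesis using bspec[OF A(1), of k] jk assms(5) by auto
    next
      case 2
      then show ?thesis using bspec[OF A(1), of j] jk assms(5) by auto
    next
      case 3
      then show ?thesis using bspec[OF bspec[OF A(2), of j], of k] jk by auto
    qed
  qed
  ultimately show ?thesis unfolding allocatable_def by (intro exI[of _ ?A]) simp
qed

lemma allocatable_mono: "allocatable v m J R' \<Longrightarrow> R' \<subseteq> R \<Longrightarrow> allocatable v m J R"
  unfolding allocatable_def by (meson subset_trans)

text \<open>An exit outside \<open>R\<close> is no exit at all, so a piece meeting \<open>B\<close>
  lies in \<open>B\<close> and is worth at most \<open>u B\<close>. Pieces demanded to be worth more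
  do not touch \<open>B\<close>, and none is lost.\<close>

lemma splittable_discard:
  assumes u: "valuation G u" and "splittable u R m k" "gate R B p" "p \<notin> R" "is_piece G B" "u B < m"
  shows "splittable u (R - B) m k"
proof -
  have "splittable u (R - B) m (k - card ({} :: ('v, 'e) pt set))"
  proof (rule splittable_remove[OF assms(2) finite.emptyI assms(6)])
    fix P assume P: "conn_piece G P" "P \<subseteq> R" "P \<inter> B \<noteq> {}"
    then have "P \<subseteq> B" using gate_avoid[OF assms(3)] assms(4) unfolding conn_piece_def by blast
    then show "u P \<le> u B" using valuation_mono[OF u] P(1) assms(5) unfolding conn_piece_def by blast
  qed
  then show ?thesis by simp
qed

lemma leaf_bags_small:
  assumes "W0 = {} \<or> (\<exists>w. W0 = {w})" "W0 \<subseteq> W" "agent_ok u m R W K" "u {} < m"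
  shows "u (region {} W0 K) < m"
  using assms by (auto simp: region_def agent_ok_def)

text \<open>An inner cut point is neither handed out nor kept, so that the shortened arc has an end
  outside the region. For \<open>c = b\<close> the arc disappears, and a live vertex at
  \<open>b\<close> stays where it is.\<close>

lemma cut_remainder:
  assumes l: "leaf F W K W0 e a b" and c: "c \<in> closed_segment a b" "c \<noteq> a"
  defines "D \<equiv> region {} W0 K \<union> seg e a c \<union> (if c = b then {} else {edge_map G e c})"
  shows "\<exists>F'. stage F' (W - W0) K \<and> card F' \<le> card F \<and> region F W K - D \<subseteq> region F' (W - W0) K \<and>
    region F' (W - W0) K \<subseteq> region F W K - (region {} W0 K \<union> seg e a c)"
proof -
  let ?R = "region F W K" and ?C = "region {} W0 K" and ?F = "F - {(e, a, b)}"
  note s = leafD(1)[OF l] and \<alpha> = leafD(2)[OF l]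
  have ea: "e \<in> edges G" "a \<in> {0..elen G e}" "b \<in> {0..elen G e}" using stage_arc[OF s \<alpha>] by auto
  have B: "region {(e, a, b)} W0 K = ?C \<union> seg e a b" by (rule region_insert)
  have rest: "region ?F (W - W0) K = ?R - (?C \<union> seg e a b)"
    using region_Diff[OF s, of "{(e, a, b)}" W0] \<alpha> leafD(3)[OF l] B by simp
  have CR: "?C \<union> seg e a b \<subseteq> ?R" using \<alpha> leafD(3)[OF l] by (auto simp: region_def)
  have disj: "?C \<inter> seg e a b = {}"
    using stage_arc(7)[OF s \<alpha>] leafD(3)[OF l] by (auto simp: region_def)
  note sf = segment_facts[OF c(1)]
  show ?thesis
  proof (cases "c = b")
    case True
    have "stage ?F (W - W0) K" by (rule stage_restrict[OF s]) auto
    moreover have "card ?F \<le> card F" using stage_finite(1)[OF s] by (intro card_mono) auto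
    ultimately show ?thesis using rest True unfolding D_def by (intro exI[of _ ?F]) simp
  next
    case False
    then have co: "c \<in> open_segment a b" using sf(6) c(2) by blast
    have s': "stage F (W - W0) K" by (rule stage_restrict[OF s]) auto
    let ?F' = "insert (e, c, b) ?F"
    have reg: "region ?F' (W - W0) K = (?R - (?C \<union> seg e a b)) \<union> seg e c b"
      using stage_shrink(2)[OF s' \<alpha> co] rest by simp
    have ec: "edge_map G e c = Pt e c"
      using subsetD[OF open_segment_real_subset[OF ea(2,3)] co] by (simp add: edge_map_inner)
    have "card ?F' \<le> Suc (card ?F)" using stage_finite(1)[OF s] by (intro card_insert_le_m1) auto
    then have "card ?F' \<le> card F" using card_Suc_Diff1[OF stage_finite(1)[OF s] \<alpha>] by simp
    moreover have "?R - D \<subseteq> region ?F' (W - W0) K"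
    proof
      fix x assume x: "x \<in> ?R - D"
      show "x \<in> region ?F' (W - W0) K"
      proof (cases "x \<in> seg e a b")
        case True
        then obtain t where t: "x = Pt e t" "t \<in> open_segment a b" by (auto simp: seg_def)
        have "t \<notin> open_segment a c" "t \<noteq> c" using x t False ec by (auto simp: D_def seg_def)
        moreover have "t \<noteq> b" using t(2) by (simp add: open_segment_def)
        ultimately have "t \<in> open_segment c b" using t(2) sf(3) by (auto simp: open_segment_def)
        then show ?thesis using t reg by (auto simp: seg_def)
      next
        case False
        then show ?thesis using x reg by (auto simp: D_def)
      qed
    qed
    moreover have "region ?F' (W - W0) K \<subseteq> ?R - (?C \<union> seg e a c)"
    proof -
      have "seg e a c \<subseteq> seg e a b" "seg e c b \<subseteq> seg e a b" "seg e a c \<inter> seg e c b = {}"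
        using sf by (auto simp: seg_def)
      then show ?thesis unfolding reg using CR disj by blast
    qed
    ultimately show ?thesis using stage_shrink(1)[OF s' \<alpha> co] by blast
  qed
qed

text \<open>The sum decreases because no summand ever grows: a cut may keep the number of arcs, but
  it serves an agent; every other step uses up an arc or, when no arcs are left, a bag.\<close>

lemma allocate:
  assumes "stage F W K" "W \<inter> S = {}" "\<not> has_cycle_minus G S" "finite J"
    and "\<And>j. j \<in> J \<Longrightarrow> valuation G (v j) \<and> v j {} < m j \<and>
      splittable (v j) (region F W K) (m j) (card J) \<and> agent_ok (v j) (m j) (region F W K) W K"
  shows "allocatable v m J (region F W K)"
  using assms
proof (induction "card J + card F + card W" arbitrary: J F W K rule: less_induct)
  case less
  note s = less.prems(1) and WS = less.prems(2) and acyclic = less.prems(3) and finJ = less.prems(4)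
    and ag = less.prems(5) and IH = less.hyps
  show ?case
  proof (cases "J = {}")
    case True
    then show ?thesis by (simp add: allocatable_def)
  next
    case Jne: False
    show ?thesis
    proof (cases "F = {}")
      case True
      show ?thesis
      proof (cases "W = {}")
        case W: True
        obtain j where j: "j \<in> J" using Jne by blast
        have R: "region F W K = {}" using True W by (simp add: region_def)
        obtain c where c: "v j {} < c" "c < m j" using ag[OF j] dense by blast
        \<comment> \<open>Pieces of the empty region are empty, yet one of them would have to be
          worth \<open>c\<close>, which exceeds \<open>v j {}\<close>.\<close>
        have "splits (v j) {} c (card J)" using ag[OF j] c R by (simp add: splittable_def)
        then obtain I :: "nat set" and P where I: "finite I" "card J \<le> card I"
          and P: "\<forall>i\<in>I. conn_piece G (P i) \<and> P i \<subseteq> {} \<and> c \<le> v j (P i)"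
          unfolding splits_def by (elim exE conjE)
        have "card J > 0" using Jne finJ by (simp add: card_gt_0_iff)
        then obtain i where "i \<in> I" using I by fastforce
        then have "c \<le> v j {}" using P by fastforce
        then show ?thesis using c by simp
      next
        case False
        then obtain w where w: "w \<in> W" by blast
        let ?R = "region F W K" and ?R' = "region F (W - {w}) K"
        have Kw: "region {} {w} K = K w" by (simp add: region_def)
        have R': "?R - K w = ?R'" using region_Diff[OF s, of "{}" "{w}"] w Kw by simp
        \<comment> \<open>Without arcs a bag is relatively open and closed and has no exit. As
          \<open>gate\<close> still asks for a point, one outside the cake is supplied, and the bag,
          too small for everyone, is discarded.\<close>
        define p :: "('v, 'e) pt" where "p = Pt undefined (- 1)"
        have p: "p \<notin> ?R" using region_points[OF s] by (auto simp: p_def points_def)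
        have ts: "topspace (subtopology T ?R) = ?R" using region_points[OF s] by auto
        have KR: "K w \<subseteq> ?R" using w by (auto simp: region_def)
        have "openin (subtopology T ?R) (K w)"
          using openin_region[OF s, of "{}" "{w}"] w True Kw by simp
        moreover have "openin (subtopology T ?R) (?R - K w - {p})"
        proof -
          have "?R - K w - {p} = ?R - K w" using p by blast
          then show ?thesis using stage_vertex(3)[OF s w] ts by (metis closedin_def)
        qed
        ultimately have g: "gate ?R (K w) p" using KR p unfolding gate_def by blast
        have "allocatable v m J ?R'"
        proof (rule IH)
          show "card J + card F + card (W - {w}) < card J + card F + card W"
            using card_Diff1_less[OF stage_finite(2)[OF s] w] by simp
          show "stage F (W - {w}) K" by (rule stage_restrict[OF s]) auto
          show "(W - {w}) \<inter> S = {}" using WS by blast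
          show "\<not> has_cycle_minus G S" "finite J" using acyclic finJ by auto
          fix j assume j: "j \<in> J"
          have "splittable (v j) (?R - K w) (m j) (card J)"
          proof (rule splittable_discard[OF _ _ g p])
            show "is_piece G (K w)" using stage_vertex(2)[OF s w] by (simp add: conn_piece_def)
            show "v j (K w) < m j" using ag[OF j] w by (simp add: agent_ok_def)
          qed (use ag[OF j] in auto)
          moreover have "agent_ok (v j) (m j) ?R' (W - {w}) K"
            by (rule agent_ok_restrict[of _ _ ?R W]) (use ag[OF j] R' in auto)
          ultimately show "valuation G (v j) \<and> v j {} < m j \<and> splittable (v j) ?R' (m j) (card J) \<and>
              agent_ok (v j) (m j) ?R' (W - {w}) K"
            using ag[OF j] R' by simp
        qed
        then show ?thesis by (rule allocatable_mono) (use R' in blast)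
      qed
    next
      case False
      let ?R = "region F W K"
      obtain F1 W0 e a b where l: "leaf F1 W K W0 e a b" and F1: "card F1 = card F" "region F1 W K = ?R"
        and W0: "W0 = {} \<or> (\<exists>w. W0 = {w})"
        using exists_leaf[OF s False acyclic WS] by blast
      let ?C = "region {} W0 K" and ?F = "F1 - {(e, a, b)}" and ?W = "W - W0"
      let ?B = "?C \<union> seg e a b"
      note s1 = leafD(1)[OF l] and \<alpha> = leafD(2)[OF l]
      have ab: "b \<noteq> a" using stage_arc(4)[OF s1 \<alpha>] by simp
      have gB: "gate ?R ?B (edge_map G e b)" using leaf_gate[OF l _ ab] F1 by simp
      have cB: "conn_piece G ?B" using leaf_conn[OF l] by simp
      have BR: "?B \<subseteq> ?R" using gB by (simp add: gate_def)
      have small: "v j ?C < m j" if "j \<in> J" for j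
        using leaf_bags_small[OF W0 leafD(3)[OF l]] ag[OF that] by blast
      have rest: "region ?F ?W K = ?R - ?B"
      proof -
        have "region {(e, a, b)} W0 K = ?B" by (rule region_insert)
        then show ?thesis using region_Diff[OF s1, of "{(e, a, b)}" W0] \<alpha> leafD(3)[OF l] F1 by simp
      qed
      have finW: "finite W" and finF1: "finite F1" using stage_finite[OF s1] by auto
      have cW: "card ?W \<le> card W" using finW by (intro card_mono) auto
      have cF: "card ?F < card F" using card_Diff1_less[OF finF1 \<alpha>] F1 by simp
      have cJ: "card (J - {i}) = card J - 1" "card (J - {i}) < card J" if "i \<in> J" for i
        using that finJ card_Diff1_less[OF finJ that] by auto
      have WS': "W' \<inter> S = {}" if "W' \<subseteq> W" for W' using WS that by blast
      show ?thesis
      proof (cases "\<exists>j0\<in>J. m j0 \<le> v j0 ?B")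
        case True
        then obtain j0 where j0: "j0 \<in> J" "m j0 \<le> v j0 ?B" by blast
        have vJ: "valuation G (v j)" if "j \<in> J" for j using ag[OF that] by simp
        obtain c i where c: "c \<in> closed_segment a b" "c \<noteq> a" and i: "i \<in> J" "m i \<le> v i (?C \<union> seg e a c)"
          and thin: "\<And>j \<delta>. j \<in> J \<Longrightarrow> \<delta> > 0 \<Longrightarrow> \<exists>X p Y q. gate (region F1 W K) X p \<and> is_piece G X \<and>
            ?C \<union> seg e a c \<union> (if c = b then {} else {edge_map G e c}) \<subseteq> X \<and>
            gate (region F1 W K) Y q \<and> is_piece G Y \<and> v j Y < m j \<and> piece_len G (X - Y) < \<delta>"
          using leaf_threshold[of F1 W K W0 e a b J v m j0, OF l finJ vJ small j0] by blast
        obtain F' where F': "stage F' ?W K" "card F' \<le> card F1"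
          "region F1 W K - (?C \<union> seg e a c \<union> (if c = b then {} else {edge_map G e c})) \<subseteq> region F' ?W K"
          "region F' ?W K \<subseteq> region F1 W K - (?C \<union> seg e a c)"
          using cut_remainder[OF l c] by blast
        have "allocatable v m (J - {i}) (region F' ?W K)"
        proof (rule IH)
          show "card (J - {i}) + card F' + card ?W < card J + card F + card W"
            using cJ[OF i(1)] F'(2) F1(1) cW by linarith
          show "stage F' ?W K" using F' by simp
          show "?W \<inter> S = {}" using WS' by blast
          show "\<not> has_cycle_minus G S" "finite (J - {i})" using acyclic finJ by auto
          fix j assume "j \<in> J - {i}"
          then have j: "j \<in> J" by blast
          have "splittable (v j) (region F1 W K) (m j) (card J)" using ag[OF j] F1 by simp
          from splittable_cut[OF vJ[OF j] this thin[OF j]]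
          have "splittable (v j) (region F' ?W K) (m j) (card (J - {i}))"
            using splittable_mono[OF _ F'(3)] cJ[OF i(1)] by simp
          moreover have "agent_ok (v j) (m j) (region F' ?W K) ?W K"
            by (rule agent_ok_restrict[of _ _ ?R W]) (use ag[OF j] F'(4) F1 in auto)
          ultimately show "valuation G (v j) \<and> v j {} < m j \<and>
              splittable (v j) (region F' ?W K) (m j) (card (J - {i})) \<and>
              agent_ok (v j) (m j) (region F' ?W K) ?W K"
            using ag[OF j] by simp
        qed
        moreover have "?C \<union> seg e a c \<subseteq> ?R"
          using leaf_gate[OF l c] F1 by (simp add: gate_def)
        ultimately show ?thesis
          using leaf_conn[OF l c(1)] i(2) F'(4) F1
          by (intro allocatable_insert[of "?C \<union> seg e a c" ?R m i v "region F' ?W K"]) auto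
      next
        case False
        then have vB: "v j ?B < m j" if "j \<in> J" for j using that by force
        have Bp: "is_piece G ?B" using cB by (simp add: conn_piece_def)
        show ?thesis
        proof (cases "edge_map G e b \<in> Vtx ` W")
          case free: False
          \<comment> \<open>The far end is outside the region, so the branch has no exit; being too
            small for every agent, it is dropped.\<close>
          then have pR: "edge_map G e b \<notin> ?R" using stage_arc(6)[OF s1 \<alpha>] F1 by simp
          have "allocatable v m J (region ?F ?W K)"
          proof (rule IH)
            show "card J + card ?F + card ?W < card J + card F + card W" using cF cW by linarith
            show "stage ?F ?W K" by (rule stage_restrict[OF s1]) auto
            show "?W \<inter> S = {}" using WS' by blast
            show "\<not> has_cycle_minus G S" "finite J" using acyclic finJ by auto
            fix j assume j: "j \<in> J"
            have "splittable (v j) (region ?F ?W K) (m j) (card J)"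
              unfolding rest using ag[OF j] gB pR Bp vB[OF j]
              by (intro splittable_discard[where p = "edge_map G e b"]) simp_all
            moreover have "agent_ok (v j) (m j) (region ?F ?W K) ?W K"
              by (rule agent_ok_restrict[of _ _ ?R W]) (use ag[OF j] rest in auto)
            ultimately show "valuation G (v j) \<and> v j {} < m j \<and>
                splittable (v j) (region ?F ?W K) (m j) (card J) \<and>
                agent_ok (v j) (m j) (region ?F ?W K) ?W K"
              using ag[OF j] by simp
          qed
          then show ?thesis by (rule allocatable_mono) (use rest in blast)
        next
          case True
          then obtain u where u: "u \<in> W" "edge_map G e b = Vtx u" by blast
          define K' where "K' = K(u := K u \<union> ?B)"
          have uW: "u \<in> ?W" and s': "stage ?F ?W K'" and R': "region ?F ?W K' = ?R"
            using leaf_merge[OF l u] F1 by (simp_all add: K'_def)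
          have K'u: "K' u = K u \<union> ?B" by (simp add: K'_def)
          \<comment> \<open>A piece that meets the enlarged bag without its vertex either meets the
            old bag, where the old bound applies, or avoids the exit of the new branch and is
            trapped in it. Hence the maximum of the two bounds.\<close>
          have loose: "\<exists>c<m j. \<forall>P. conn_piece G P \<longrightarrow> P \<subseteq> ?R \<longrightarrow> P \<inter> K' w \<noteq> {} \<longrightarrow> Vtx w \<notin> P \<longrightarrow> v j P \<le> c"
            if j: "j \<in> J" and w: "w \<in> ?W" for j w
          proof -
            obtain c where c: "c < m j"
              "\<And>P. conn_piece G P \<Longrightarrow> P \<subseteq> ?R \<Longrightarrow> P \<inter> K w \<noteq> {} \<Longrightarrow> Vtx w \<notin> P \<Longrightarrow> v j P \<le> c"
              using ag[OF j] w unfolding agent_ok_def by (metis DiffD1)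
            have "v j P \<le> max c (v j ?B)"
              if P: "conn_piece G P" "P \<subseteq> ?R" "P \<inter> K' w \<noteq> {}" "Vtx w \<notin> P" for P
            proof (cases "P \<inter> K w = {}")
              case True
              then have wu: "w = u" and "P \<inter> ?B \<noteq> {}" using P(3) by (auto simp: K'_def split: if_splits)
              then have "P \<subseteq> ?B"
                using gate_avoid[OF gB _ P(2)] P(1,4) u(2) unfolding conn_piece_def by auto
              then have "v j P \<le> v j ?B"
                using valuation_mono Bp P(1) ag[OF j] unfolding conn_piece_def by blast
              then show ?thesis by simp
            next
              case False
              then show ?thesis using c(2)[OF P(1,2)] P(4) by force
            qed
            then show ?thesis using c(1) vB[OF j] by (intro exI[of _ "max c (v j ?B)"]) auto
          qed
          have smallK': "v j (K' w) < m j" if "j \<in> J" "w \<in> ?W" "w \<noteq> u" for j w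
            using ag[OF that(1)] that(2,3) by (simp add: agent_ok_def K'_def)
          show ?thesis
          proof (cases "\<exists>i\<in>J. m i \<le> v i (K' u)")
            case True
            then obtain i where i: "i \<in> J" "m i \<le> v i (K' u)" by blast
            let ?W' = "?W - {u}"
            have reg: "region ?F ?W' K' = ?R - K' u"
            proof -
              have "region {} {u} K' = K' u" by (simp add: region_def)
              then show ?thesis using region_Diff[OF s', of "{}" "{u}"] uW R' by simp
            qed
            have "allocatable v m (J - {i}) (region ?F ?W' K')"
            proof (rule IH)
              have "card ?W' \<le> card W" using finW by (intro card_mono) auto
              then show "card (J - {i}) + card ?F + card ?W' < card J + card F + card W"
                using cJ[OF i(1)] cF by linarith
              show "stage ?F ?W' K'" by (rule stage_restrict[OF s']) auto
              show "?W' \<inter> S = {}" using WS' by blast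
              show "\<not> has_cycle_minus G S" "finite (J - {i})" using acyclic finJ by auto
              fix j assume "j \<in> J - {i}"
              then have j: "j \<in> J" by blast
              obtain c where c: "c < m j" "\<And>P. conn_piece G P \<Longrightarrow> P \<subseteq> ?R \<Longrightarrow> P \<inter> K' u \<noteq> {} \<Longrightarrow>
                  Vtx u \<notin> P \<Longrightarrow> v j P \<le> c"
                using loose[OF j uW] by blast
              have "splittable (v j) ?R (m j) (card J)" using ag[OF j] by simp
              \<comment> \<open>The whole bag is handed out, but only the piece through
                \<open>Vtx u\<close> is charged: pieces worth more than \<open>c\<close> that avoid
                this vertex do not meet the bag.\<close>
              then have "splittable (v j) (?R - K' u) (m j) (card J - card {Vtx u :: ('v, 'e) pt})"
                by (rule splittable_remove[OF _ _ c(1)]) (use c(2) in auto)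
              then have "splittable (v j) (region ?F ?W' K') (m j) (card (J - {i}))"
                using cJ[OF i(1)] reg by simp
              moreover have "agent_ok (v j) (m j) ?R ?W' K'"
                using smallK'[OF j] loose[OF j] by (simp add: agent_ok_def)
              then have "agent_ok (v j) (m j) (region ?F ?W' K') ?W' K'"
                by (rule agent_ok_restrict) (use reg in auto)
              ultimately show "valuation G (v j) \<and> v j {} < m j \<and>
                  splittable (v j) (region ?F ?W' K') (m j) (card (J - {i})) \<and>
                  agent_ok (v j) (m j) (region ?F ?W' K') ?W' K'"
                using ag[OF j] by simp
            qed
            moreover have "K' u \<subseteq> ?R" using R' uW by (auto simp: region_def)
            ultimately show ?thesis
              using stage_vertex(2)[OF s' uW] i(2) reg
              by (intro allocatable_insert[of "K' u" ?R m i v "region ?F ?W' K'"]) auto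
          next
            case False
            have "allocatable v m J (region ?F ?W K')"
            proof (rule IH)
              show "card J + card ?F + card ?W < card J + card F + card W" using cF cW by linarith
              show "stage ?F ?W K'" using s' .
              show "?W \<inter> S = {}" using WS' by blast
              show "\<not> has_cycle_minus G S" "finite J" using acyclic finJ by auto
              fix j assume j: "j \<in> J"
              have "v j (K' w) < m j" if "w \<in> ?W" for w
                using smallK'[OF j that] False j by (cases "w = u") force+
              then have "agent_ok (v j) (m j) ?R ?W K'"
                using loose[OF j] by (simp add: agent_ok_def)
              then show "valuation G (v j) \<and> v j {} < m j \<and>
                  splittable (v j) (region ?F ?W K') (m j) (card J) \<and>
                  agent_ok (v j) (m j) (region ?F ?W K') ?W K'"
                using ag[OF j] R' by simp
            qed
            then show ?thesis using R' by simp
          qed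
        qed
      qed
    qed
  qed
qed

section \<open>From forests to arbitrary graphs\<close>

lemma mms_splittable:
  assumes u: "valuation G u" and S: "S \<subseteq> verts G" "card S = r" and n: "1 \<le> n"
  shows "splittable u (points G - Vtx ` S) (mms G u (n + r)) n"
proof -
  let ?k = "n + r" and ?Z = "Vtx ` S :: ('v, 'e) pt set"
  let ?val = "\<lambda>P. Min ((\<lambda>j. u (P j)) ` {..<?k})"
  have finS: "finite S" using S finite_verts finite_subset by blast
  have "splittable u (points G) (mms G u ?k) ?k"
    unfolding splittable_def
  proof (intro allI impI)
    fix c assume c: "c < mms G u ?k"
    \<comment> \<open>Copies of the empty piece form a partition, so the supremum ranges over a
      nonempty set and every \<open>c\<close> below it is exceeded by some partition.\<close>
    have "is_partition G ?k (\<lambda>_. {})" by (simp add: is_partition_def conn_piece_def)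
    then have ne: "?val ` {P. is_partition G ?k P} \<noteq> {}" by blast
    obtain P where P: "is_partition G ?k P" "c < ?val P"
      using less_cSupD[OF ne c[unfolded mms_def]] by blast
    have "c \<le> u (P j)" if "j < ?k" for j
    proof -
      have "?val P \<le> u (P j)" using that by (intro Min_le) auto
      then show ?thesis using P(2) by simp
    qed
    moreover have "P j \<subseteq> points G" if "j < ?k" for j
      using P(1) that by (auto simp: is_partition_def conn_piece_def is_piece_def)
    ultimately show "splits u (points G) c ?k"
      using P(1) unfolding splits_def is_partition_def
      by (intro exI[of _ "{..<?k}"] exI[of _ P]) simp
  qed
  then have "splittable u (points G - ?Z) (mms G u ?k) (?k - card ?Z)"
    \<comment> \<open>The removed set is also the set \<open>Z\<close> of charged points, so the
      condition on pieces is vacuous and any number below the share can serve as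
      \<open>c0\<close>.\<close>
    by (rule splittable_remove[where ?c0.0 = "mms G u ?k - 1"]) (use finS in auto)
  moreover have "card ?Z = r" using S(2) by (simp add: card_image inj_on_def)
  ultimately show ?thesis by simp
qed

text \<open>Deleting all vertices destroys every cycle, so the minimum in \<open>fvs_num\<close> is
  taken over a nonempty set and is attained.\<close>

lemma fvs_exists: "\<exists>S. S \<subseteq> verts G \<and> card S = fvs_num G \<and> \<not> has_cycle_minus G S"
proof -
  have "\<not> has_cycle_minus G (verts G)" by (auto simp: has_cycle_minus_def)
  then have "\<exists>r S. S \<subseteq> verts G \<and> card S = r \<and> \<not> has_cycle_minus G S" by blast
  then show ?thesis unfolding fvs_num_def by (rule LeastI_ex)
qed

lemma mms_allocatable:
  assumes n: "1 \<le> n" and v: "\<And>i. i < n \<Longrightarrow> valuation G (v i)"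
  shows "\<exists>A. (\<forall>i<n. conn_piece G (A i)) \<and>
             (\<forall>i<n. \<forall>j<n. i \<noteq> j \<longrightarrow> A i \<inter> A j = {}) \<and>
             (\<forall>i<n. v i (A i) \<ge> mms G (v i) (n + fvs_num G))"
proof -
  obtain S where S: "S \<subseteq> verts G" "card S = fvs_num G" "\<not> has_cycle_minus G S"
    using fvs_exists by blast
  define m where "m i = mms G (v i) (n + fvs_num G)" for i
  \<comment> \<open>Agents content with the empty piece are set aside and receive it at the end. The
    comparison is with \<open>v i {}\<close> and not with 0, because in a graph without points
    nothing forces this value to be 0.\<close>
  define J where "J = {i. i < n \<and> v i {} < m i}"
  let ?F = "(\<lambda>e. (e, 0, elen G e)) ` edges G" and ?W = "verts G - S"
  let ?K = "\<lambda>w. {Vtx w} :: ('v, 'e) pt set"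
  have finJ: "finite J" by (simp add: J_def)
  have cJ: "card J \<le> n" using card_mono[of "{..<n}" J] by (auto simp: J_def)
  have "allocatable v m J (region ?F ?W ?K)"
  proof (rule allocate[OF initial_stage _ S(3) finJ])
    show "?W \<inter> S = {}" by blast
    fix j assume "j \<in> J"
    then have j: "j < n" "v j {} < m j" by (auto simp: J_def)
    have "splittable (v j) (region ?F ?W ?K) (m j) n"
      unfolding initial_region m_def using mms_splittable[OF v[OF j(1)] S(1,2) n] .
    then have "splittable (v j) (region ?F ?W ?K) (m j) (card J)"
      using cJ unfolding splittable_def splits_def by (meson order_trans)
    moreover have "v j {Vtx w} < m j" if "w \<in> ?W" for w
    proof -
      have "v j {Vtx w} = 0" "0 \<le> v j {}"
        using v[OF j(1)] that unfolding valuation_def points_def by auto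
      then show ?thesis using j(2) by simp
    qed
    then have "agent_ok (v j) (m j) (region ?F ?W ?K) ?W ?K"
      using j(2) unfolding agent_ok_def by auto
    ultimately show "valuation G (v j) \<and> v j {} < m j \<and>
        splittable (v j) (region ?F ?W ?K) (m j) (card J) \<and>
        agent_ok (v j) (m j) (region ?F ?W ?K) ?W ?K"
      using v j by simp
  qed
  then obtain A where A: "\<forall>j\<in>J. conn_piece G (A j) \<and> A j \<subseteq> region ?F ?W ?K \<and> m j \<le> v j (A j)"
    "\<forall>i\<in>J. \<forall>j\<in>J. i \<noteq> j \<longrightarrow> A i \<inter> A j = {}"
    unfolding allocatable_def by (elim exE conjE)
  let ?A = "\<lambda>i. if i \<in> J then A i else {}"
  have "conn_piece G (?A i) \<and> m i \<le> v i (?A i)" if "i < n" for i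
    using bspec[OF A(1), of i] that by (auto simp: J_def conn_piece_def)
  moreover have "?A i \<inter> ?A j = {}" if "i \<noteq> j" for i j using A(2) that by auto
  ultimately show ?thesis unfolding m_def by (intro exI[of _ ?A]) simp
qed

end

theorem theorem2:
  fixes G :: "('v, 'e) cgraph" and n :: nat and v :: "nat \<Rightarrow> ('v, 'e) pt set \<Rightarrow> real"
  assumes "wf_cgraph G" and "n \<ge> 1" and "\<forall>i<n. valuation G (v i)"
  shows "\<exists>A. (\<forall>i<n. conn_piece G (A i)) \<and>
             (\<forall>i<n. \<forall>j<n. i \<noteq> j \<longrightarrow> A i \<inter> A j = {}) \<and>
             (\<forall>i<n. v i (A i) \<ge> mms G (v i) (n + fvs_num G))"
proof -
  interpret cake G by standard (rule assms(1))
  show ?thesis using assms(2,3) by (intro mms_allocatable) auto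
qed

end
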